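(* Let $H$ be a semisimple Hopf algebra over an algebraically closed field $k$ of characteristic $0$ and let $n>1$. For $a^1,\dots,a^n\in H$ define the $n$-th commutator $$\{a^1,\dots,a^n\}=\sum a^1_1\cdots a^n_1\,S(a^1_2)\cdots S(a^n_2),$$ and let $\mathrm{Com}_n=\mathrm{span}_k\{\{a^1,\dots,a^n\}\mid a^i\in H,\ 1\le i\le n\}$. Then the commutator subalgebra $H'$ of $H$ is the algebra generated by $\mathrm{Com}_n$. In particular, every generalized commutator $\{a^1,\dots,a^n\}$ is a linear combination of products of commutators $\{a,b\}=\sum a_1b_1S(a_2)S(b_2)$, $a,b\in H$.
   Context: $H$ is finite dimensional with comultiplication $\Delta(h)=\sum h_1\otimes h_2$ (Sweedler notation; $\Delta(a^i)=\sum a^i_1\otimes a^i_2$), counit $\varepsilon$ and antipode $S$. A subspace $N\subseteq H$ is a left coideal if $\Delta(N)\subseteq H\otimes N$; a subalgebra $N$ is normal if $\sum h_1xS(h_2)\in N$ for all $h\in H$, $x\in N$; $N^+=N\cap\ker\varepsilon$. The commutator subalgebra $H'$ of $H$ is the normal left coideal subalgebra of $H$ for which $H/(HH'^+)$ is commutative and which is minimal with respect to this property; equivalently $H'=\{h\in H\mid \sigma\rightharpoonup h=h\ \text{for all }\sigma\in G(H^* )\}$, where $G(H^* )$ is the group of group-like elements of $H^*$ (algebra maps $H\to k$) and $\sigma\rightharpoonup h=\sum\langle\sigma,h_2\rangle h_1$. *)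

theory Defs
  imports
    "HOL-Library.Poly_Mapping"
    "HOL-Computational_Algebra.Polynomial"
begin

section \<open>Tensor powers of a vector space\<close>

text \<open>
  The vector space \<open>V\<close> is a whole type with a scalar multiplication \<open>scale\<close>. The direct sum of all
  tensor powers of \<open>V\<close> is the free vector space on the words over \<open>V\<close> (the word \<open>[x, y]\<close> stands
  for the pure tensor of \<open>x\<close> and \<open>y\<close>) modulo the multilinear relations, which never mix words of
  different lengths. Every tensor is a sum of pure tensors, so tensors are written as finite lists
  of words, and \<open>tensor_eq\<close> says that two such lists represent the same tensor.
\<close>

definition free_scale :: "'k::field \<Rightarrow> ('x \<Rightarrow>\<^sub>0 'k) \<Rightarrow> ('x \<Rightarrow>\<^sub>0 'k)"
  where "free_scale c = Poly_Mapping.map ((*) c)"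

lemma lookup_free_scale [simp]: "Poly_Mapping.lookup (free_scale c f) w = c * Poly_Mapping.lookup f w"
  by (simp add: free_scale_def Poly_Mapping.map.rep_eq when_def)

interpretation free: vector_space "free_scale :: 'k::field \<Rightarrow> ('x \<Rightarrow>\<^sub>0 'k) \<Rightarrow> ('x \<Rightarrow>\<^sub>0 'k)"
  by unfold_locales (auto intro!: poly_mapping_eqI simp: lookup_add algebra_simps)

definition multilinear_relations :: "('k::field \<Rightarrow> 'v::ab_group_add \<Rightarrow> 'v) \<Rightarrow> ('v list \<Rightarrow>\<^sub>0 'k) set"
  where "multilinear_relations scale =
    {Poly_Mapping.single (u @ (x + y) # v) 1 - Poly_Mapping.single (u @ x # v) 1
       - Poly_Mapping.single (u @ y # v) 1 | u x y v. True} \<union>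
    {Poly_Mapping.single (u @ scale c x # v) 1 - free_scale c (Poly_Mapping.single (u @ x # v) 1)
       | u c x v. True}"

definition tensor_eq ::
    "('k::field \<Rightarrow> 'v::ab_group_add \<Rightarrow> 'v) \<Rightarrow> 'v list list \<Rightarrow> 'v list list \<Rightarrow> bool"
  where "tensor_eq scale s t \<longleftrightarrow>
    (\<Sum>w\<leftarrow>s. Poly_Mapping.single w 1) - (\<Sum>w\<leftarrow>t. Poly_Mapping.single w 1)
      \<in> free.span (multilinear_relations scale)"


section \<open>Algebras\<close>

locale k_algebra = vector_space scale
  for scale :: "'k::field \<Rightarrow> 'h::ring_1 \<Rightarrow> 'h" +
  assumes scale_mult_left: "scale c a * b = scale c (a * b)"
    and scale_mult_right: "a * scale c b = scale c (a * b)"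
begin

definition subalgebra :: "'h set \<Rightarrow> bool"
  where "subalgebra N \<longleftrightarrow> subspace N \<and> 1 \<in> N \<and> (\<forall>x\<in>N. \<forall>y\<in>N. x * y \<in> N)"

definition algebra_generated :: "'h set \<Rightarrow> 'h set"
  where "algebra_generated X = subalgebra hull X"

definition left_ideal :: "'h set \<Rightarrow> bool"
  where "left_ideal I \<longleftrightarrow> subspace I \<and> (\<forall>a. \<forall>x\<in>I. a * x \<in> I)"

text \<open>Semisimplicity: the left regular module is completely reducible.\<close>

definition semisimple :: bool
  where "semisimple \<longleftrightarrow>
    (\<forall>I. left_ideal I \<longrightarrow>
       (\<exists>J. left_ideal J \<and> I \<inter> J = {0} \<and> {x + y | x y. x \<in> I \<and> y \<in> J} = UNIV))"

end


section \<open>Hopf algebras\<close>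

lemma sum_list_concat_map:
  fixes f :: "'a \<Rightarrow> 'b::monoid_add list"
  shows "sum_list (concat (map f xs)) = (\<Sum>x\<leftarrow>xs. sum_list (f x))"
  by (induction xs) auto

text \<open>
  The comultiplication is given by representatives: \<open>\<Delta> h\<close> is a list of pairs \<open>(h\<^sub>1, h\<^sub>2)\<close> whose
  pure tensors add up to the element \<open>\<Sum> h\<^sub>1 \<otimes> h\<^sub>2\<close> of the tensor square, and all axioms for \<open>\<Delta>\<close> are
  equations of tensors. Hence every comultiplication with values in the tensor square is covered,
  for any choice of representatives, and a Sweedler sum is a sum over the list \<open>\<Delta> h\<close>.
\<close>

locale hopf_algebra = k_algebra scale
  for scale :: "'k::field \<Rightarrow> 'h::ring_1 \<Rightarrow> 'h" +
  fixes \<Delta> :: "'h \<Rightarrow> ('h \<times> 'h) list"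
    and \<epsilon> :: "'h \<Rightarrow> 'k"
    and S :: "'h \<Rightarrow> 'h"
  assumes \<Delta>_add: "tensor_eq scale [[x, y]. (x, y) \<leftarrow> \<Delta> (a + b)] [[x, y]. (x, y) \<leftarrow> \<Delta> a @ \<Delta> b]"
    and \<Delta>_scale: "tensor_eq scale [[x, y]. (x, y) \<leftarrow> \<Delta> (scale c a)] [[scale c x, y]. (x, y) \<leftarrow> \<Delta> a]"
    and \<Delta>_one: "tensor_eq scale [[x, y]. (x, y) \<leftarrow> \<Delta> 1] [[1, 1]]"
    and \<Delta>_mult: "tensor_eq scale [[x, y]. (x, y) \<leftarrow> \<Delta> (a * b)]
          [[x * x', y * y']. (x, y) \<leftarrow> \<Delta> a, (x', y') \<leftarrow> \<Delta> b]"
    and coassoc: "tensor_eq scale [[x1, x2, y]. (x, y) \<leftarrow> \<Delta> a, (x1, x2) \<leftarrow> \<Delta> x]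
          [[x, y1, y2]. (x, y) \<leftarrow> \<Delta> a, (y1, y2) \<leftarrow> \<Delta> y]"
    and \<epsilon>_linear: "Vector_Spaces.linear scale (*) \<epsilon>"
    and \<epsilon>_one: "\<epsilon> 1 = 1"
    and \<epsilon>_mult: "\<epsilon> (a * b) = \<epsilon> a * \<epsilon> b"
    and counit_left: "(\<Sum>(x, y)\<leftarrow>\<Delta> a. scale (\<epsilon> x) y) = a"
    and counit_right: "(\<Sum>(x, y)\<leftarrow>\<Delta> a. scale (\<epsilon> y) x) = a"
    and S_linear: "Vector_Spaces.linear scale scale S"
    and antipode_left: "(\<Sum>(x, y)\<leftarrow>\<Delta> a. S x * y) = scale (\<epsilon> a) 1"
    and antipode_right: "(\<Sum>(x, y)\<leftarrow>\<Delta> a. x * S y) = scale (\<epsilon> a) 1"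
begin

text \<open>\<open>\<Delta>(N) \<subseteq> H \<otimes> N\<close>: each \<open>\<Delta> n\<close> has some representative with all right legs in \<open>N\<close>.\<close>

definition left_coideal :: "'h set \<Rightarrow> bool"
  where "left_coideal N \<longleftrightarrow> subspace N \<and>
    (\<forall>n\<in>N. \<exists>t. snd ` set t \<subseteq> N \<and> tensor_eq scale [[x, y]. (x, y) \<leftarrow> \<Delta> n] [[x, y]. (x, y) \<leftarrow> t])"

definition normal :: "'h set \<Rightarrow> bool"
  where "normal N \<longleftrightarrow> (\<forall>h. \<forall>n\<in>N. (\<Sum>(h1, h2)\<leftarrow>\<Delta> h. h1 * n * S h2) \<in> N)"

definition normal_left_coideal_subalgebra :: "'h set \<Rightarrow> bool"
  where "normal_left_coideal_subalgebra N \<longleftrightarrow> subalgebra N \<and> left_coideal N \<and> normal N"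

definition augmentation :: "'h set \<Rightarrow> 'h set"
  where "augmentation N = {x \<in> N. \<epsilon> x = 0}"

definition ideal_of :: "'h set \<Rightarrow> 'h set"
  where "ideal_of N = span {h * x | h x. x \<in> augmentation N}"

text \<open>
  Commutativity of the quotient of \<open>H\<close> by the subspace \<open>HN\<^sup>+\<close>, i.e.\ \<open>ab\<close> and \<open>ba\<close> always have the
  same residue class. If this holds then the left ideal \<open>HN\<^sup>+\<close> is automatically two-sided,
  since \<open>xh = hx + (xh - hx)\<close>, so the quotient is indeed an algebra.
\<close>

definition commutative_quotient :: "'h set \<Rightarrow> bool"
  where "commutative_quotient N \<longleftrightarrow> (\<forall>a b. a * b - b * a \<in> ideal_of N)"

definition is_commutator_subalgebra :: "'h set \<Rightarrow> bool"
  where "is_commutator_subalgebra N \<longleftrightarrow>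
    normal_left_coideal_subalgebra N \<and> commutative_quotient N \<and>
    (\<forall>M. normal_left_coideal_subalgebra M \<and> commutative_quotient M \<and> M \<subseteq> N \<longrightarrow> M = N)"

text \<open>
  \<open>product_lists (map \<Delta> [a\<^sup>1, \<dots>, a\<^sup>n])\<close> runs through all ways of picking one pair
  \<open>(a\<^sup>i\<^sub>1, a\<^sup>i\<^sub>2)\<close> from each list \<open>\<Delta> a\<^sup>i\<close>.
\<close>

definition commutator :: "'h list \<Rightarrow> 'h"
  where "commutator as =
    (\<Sum>ps\<leftarrow>product_lists (map \<Delta> as). prod_list (map fst ps) * prod_list (map (\<lambda>p. S (snd p)) ps))"

lemma commutator_two:
  "commutator [a, b] = (\<Sum>(a1, a2)\<leftarrow>\<Delta> a. \<Sum>(b1, b2)\<leftarrow>\<Delta> b. a1 * b1 * S a2 * S b2)"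
  unfolding commutator_def
  by (simp add: map_concat sum_list_concat_map o_def case_prod_unfold mult.assoc)

definition Com :: "nat \<Rightarrow> 'h set"
  where "Com n = span {commutator as | as. length as = n}"

end

end

theory Submission
  imports Defs "HOL-Library.Function_Algebras"
begin

text \<open>
  Everything rests on the commutators of two elements: the algebra \<open>A\<close> that they generate
  (\<open>comm_algebra\<close>) contains all longer commutators, because the identity
  \<open>ab c\<^sub>1\<dots>c\<^sub>r a\<^sup>-\<^sup>1b\<^sup>-\<^sup>1 c\<^sub>1\<^sup>-\<^sup>1\<dots>c\<^sub>r\<^sup>-\<^sup>1 = [a,b] \<cdot> (ba) c\<^sub>1\<dots>c\<^sub>r (ba)\<^sup>-\<^sup>1 c\<^sub>1\<^sup>-\<^sup>1\<dots>c\<^sub>r\<^sup>-\<^sup>1\<close>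
  for elements of a group has a Hopf-algebraic form (\<open>commutator_Cons_Cons\<close>), in which \<open>S\<close> takes the
  place of the inverse and each repeated letter is split by \<open>\<Delta>\<close>. Conversely a commutator of
  two elements is a longer one with entries \<open>1\<close> appended. Hence the algebra generated by \<open>Com n\<close> is
  \<open>A\<close> for every \<open>n > 1\<close>, and it has to be shown that \<open>A\<close> is the least normal left coideal subalgebra
  with commutative quotient; least implies that it is the only minimal one.

  That \<open>A\<close> is a normal left coideal subalgebra with commutative quotient is again group theory with
  Sweedler sums: \<open>h[a,b]h\<^sup>-\<^sup>1 = [ha,b][b,h]\<close> gives normality (\<open>ad_comm\<close>) and \<open>ab = [a,b]ba\<close> gives
  commutativity modulo \<open>A\<^sup>+H\<close> (\<open>comm_reorder\<close>). For normal \<open>A\<close> the right ideal \<open>A\<^sup>+H\<close> lies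
  in \<open>HA\<^sup>+\<close> as soon as \<open>S\<close> is surjective; semisimplicity supplies a normalized integral,
  which makes \<open>S\<close> injective (\<open>inj_S\<close>), hence bijective.

  The deeper part is that \<open>A\<close> lies in every normal left coideal subalgebra \<open>M\<close> with commutative
  quotient. Let \<open>N\<close> be the algebra generated by \<open>M\<close> and the commutators. Modulo \<open>HM\<^sup>+\<close> every
  commutator is a scalar, so \<open>HN\<^sup>+ = HM\<^sup>+\<close>. The dimension formula
  \<open>dim H = dim M \<cdot> dim (H/HM\<^sup>+)\<close>
  (\<open>dim_formula\<close>) holds for each left coideal subalgebra, so \<open>M\<close> and \<open>N\<close> have the same dimension, and
  \<open>A \<subseteq> N = M\<close>.

  The dimension formula is the numerical shadow of Skryabin's theorem that \<open>H\<close> is free over \<open>M\<close>. Let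
  \<open>c\<close> be the maximum of \<open>dim (H/HI) / dim (M/I)\<close> over the proper left ideals \<open>I\<close> of \<open>M\<close>. Adding cyclic
  submodules one after the other shows that enlarging an \<open>M\<close>-submodule \<open>U\<close> of an \<open>H\<close>-module by \<open>d\<close>
  dimensions enlarges \<open>HU\<close> by at most \<open>cd\<close> dimensions (\<open>dim_generated_growth\<close>). Now let \<open>I\<close> attain
  the maximum. The Galois map \<open>x \<otimes> y \<mapsto> \<Sum> xy\<^sub>1 \<otimes> y\<^sub>2\<close> carries \<open>H \<otimes> I\<close> to an \<open>M\<close>-submodule \<open>U\<close> of
  \<open>H \<otimes> M\<close> for which passing from \<open>U\<close> to \<open>H \<otimes> M\<close> attains the bound, so every intermediate step
  attains it too. The element \<open>1 \<otimes> 1\<close> generates a copy of \<open>M\<close> that meets \<open>U\<close> only in \<open>0\<close>, since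
  otherwise \<open>I\<close> would contain a nonzero left coideal and \<open>HI\<close> would be \<open>H\<close>. Reading the steps inside
  this copy shows that all left ideals \<open>J\<close> satisfy \<open>dim (H/HJ) = c dim (M/J)\<close>
  (\<open>left_ideal_ratio\<close>); the cases \<open>J = 0\<close> and \<open>J = M\<^sup>+\<close> give the formula.
\<close>

section \<open>Multilinear maps on tensors\<close>

text \<open>
  The universal property of the tensor powers: a multilinear \<open>L\<close> extends linearly to the free vector
  space on words, and the extension kills the multilinear relations.
\<close>

lemma (in vector_space) sum_list_tensor_eq:
  fixes L :: "'b list \<Rightarrow> 'b"
  assumes add: "\<And>u x y v. L (u @ (x + y) # v) = L (u @ x # v) + L (u @ y # v)"
    and homogeneous: "\<And>u c x v. L (u @ scale c x # v) = scale c (L (u @ x # v))"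
    and eq: "tensor_eq scale s t"
  shows "(\<Sum>w\<leftarrow>s. L w) = (\<Sum>w\<leftarrow>t. L w)"
proof -
  define E where "E p = (\<Sum>w\<in>Poly_Mapping.keys p. scale (Poly_Mapping.lookup p w) (L w))" for p
  have E_eq: "E p = (\<Sum>w\<in>A. scale (Poly_Mapping.lookup p w) (L w))"
    if "finite A" "Poly_Mapping.keys p \<subseteq> A" for p A
    unfolding E_def using that by (intro sum.mono_neutral_left) (auto simp: in_keys_iff)
  have E_add: "E (p + q) = E p + E q" for p q
  proof -
    let ?A = "Poly_Mapping.keys p \<union> Poly_Mapping.keys q"
    have "E (p + q) = (\<Sum>w\<in>?A. scale (Poly_Mapping.lookup (p + q) w) (L w))"
      using Poly_Mapping.keys_add[of p q] by (intro E_eq) auto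
    also have "\<dots> = E p + E q"
      by (subst (1 2) E_eq[of ?A]) (auto simp: lookup_add scale_left_distrib sum.distrib)
    finally show ?thesis .
  qed
  have E_scale: "E (free_scale c p) = scale c (E p)" for c p
    by (subst (1 2) E_eq[of "Poly_Mapping.keys p"]) (auto simp: scale_sum_right in_keys_iff)
  have E_single: "E (Poly_Mapping.single w 1) = L w" for w
    by (subst E_eq[of "{w}"]) auto
  have E_uminus: "E (- p) = - E p" for p
    using E_add[of p "- p"] by (simp add: E_def add_eq_0_iff)
  have E_diff: "E (p - q) = E p - E q" for p q
    using E_add[of p "- q"] by (simp add: E_uminus)
  have E_sum_list: "E (\<Sum>w\<leftarrow>ws. Poly_Mapping.single w 1) = (\<Sum>w\<leftarrow>ws. L w)" for ws
    by (induction ws) (simp_all add: E_add E_single, simp add: E_def)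
  have "E p = 0" if "p \<in> free.span (multilinear_relations scale)" for p
    using that
  proof (induction rule: free.span_induct_alt)
    case base
    then show ?case by (simp add: E_def)
  next
    case (step c x y)
    from step(1) have "E x = 0"
      unfolding multilinear_relations_def
      by (auto simp: E_diff E_single E_scale add homogeneous)
    with step(2) show ?case by (simp add: E_add E_scale)
  qed
  from this[OF eq[unfolded tensor_eq_def]] show ?thesis
    by (simp add: E_diff E_sum_list)
qed

section \<open>Sweedler sums\<close>

context hopf_algebra
begin

definition lin :: "('h \<Rightarrow> 'h) \<Rightarrow> bool"
  where "lin f \<longleftrightarrow> (\<forall>x y. f (x + y) = f x + f y) \<and> (\<forall>c x. f (scale c x) = scale c (f x))"

definition form :: "('h \<Rightarrow> 'k) \<Rightarrow> bool"
  where "form f \<longleftrightarrow> (\<forall>x y. f (x + y) = f x + f y) \<and> (\<forall>c x. f (scale c x) = c * f x)"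

text \<open>
  The sum \<open>\<Sum> F(a\<^sub>1, a\<^sub>2)\<close>. It refers to the chosen representative of the tensor \<open>\<Delta> a\<close>, so only for
  bilinear \<open>F\<close> is it meaningful; hence the hypotheses of linearity in each variable below. The rules
  \<open>lin_intros\<close> discharge them by following the structure of the term.
\<close>

definition sw :: "'h \<Rightarrow> ('h \<Rightarrow> 'h \<Rightarrow> 'h) \<Rightarrow> 'h"
  where "sw a F = (\<Sum>(x, y)\<leftarrow>\<Delta> a. F x y)"

named_theorems lin_intros

lemma lin_add: "lin f \<Longrightarrow> f (x + y) = f x + f y"
  and lin_scale: "lin f \<Longrightarrow> f (scale c x) = scale c (f x)"
  by (auto simp: lin_def)

lemma lin_zero: "lin f \<Longrightarrow> f 0 = 0"
  using lin_scale[of f 0 0] by simp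

lemma lin_diff: "lin f \<Longrightarrow> f (x - y) = f x - f y"
  using lin_add[of f "x - y" y] by (simp add: algebra_simps)

lemma lin_sum: "lin f \<Longrightarrow> f (sum g A) = (\<Sum>x\<in>A. f (g x))"
  by (induction A rule: infinite_finite_induct) (auto simp: lin_add lin_zero)

lemma lin_sum_list: "lin f \<Longrightarrow> f (\<Sum>x\<leftarrow>xs. g x) = (\<Sum>x\<leftarrow>xs. f (g x))"
  by (induction xs) (auto simp: lin_add lin_zero)

lemma lin_sw: "lin f \<Longrightarrow> f (sw a F) = sw a (\<lambda>x y. f (F x y))"
  by (simp add: sw_def lin_sum_list case_prod_unfold)

lemma form_add: "form f \<Longrightarrow> f (x + y) = f x + f y"
  and form_scale: "form f \<Longrightarrow> f (scale c x) = c * f x"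
  by (auto simp: form_def)

lemma lin_id [lin_intros]: "lin (\<lambda>x. x)"
  by (simp add: lin_def)

lemma lin_mult_right [lin_intros]: "lin f \<Longrightarrow> lin (\<lambda>x. f x * c)"
  by (simp add: lin_def scale_mult_left distrib_right)

lemma lin_mult_left [lin_intros]: "lin f \<Longrightarrow> lin (\<lambda>x. c * f x)"
  by (simp add: lin_def scale_mult_right distrib_left)

lemma lin_scale_right [lin_intros]: "lin f \<Longrightarrow> lin (\<lambda>x. scale c (f x))"
  by (simp add: lin_def scale_right_distrib mult.commute)

lemma lin_scale_form [lin_intros]: "form f \<Longrightarrow> lin (\<lambda>x. scale (f x) v)"
  by (simp add: lin_def form_def scale_left_distrib)

lemma lin_sum_fun [lin_intros]: "(\<And>i. i \<in> A \<Longrightarrow> lin (f i)) \<Longrightarrow> lin (\<lambda>x. \<Sum>i\<in>A. f i x)"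
  by (simp add: lin_def sum.distrib scale_sum_right)

lemma lin_sum_list_fun [lin_intros]:
  "(\<And>i. lin (\<lambda>x. f x i)) \<Longrightarrow> lin (\<lambda>x. \<Sum>i\<leftarrow>xs. f x i)"
  by (induction xs) (auto simp: lin_def scale_right_distrib algebra_simps)

lemma lin_S_raw: "lin S"
  using S_linear by (simp add: lin_def Vector_Spaces.linear_def module_hom_def module_hom_axioms_def)

lemma lin_S [lin_intros]: "lin f \<Longrightarrow> lin (\<lambda>x. S (f x))"
  using lin_S_raw by (simp add: lin_def)

lemma form_eps_raw: "form \<epsilon>"
  using \<epsilon>_linear by (simp add: form_def Vector_Spaces.linear_def module_hom_def module_hom_axioms_def)

lemma form_eps [lin_intros]: "lin f \<Longrightarrow> form (\<lambda>x. \<epsilon> (f x))"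
  using form_eps_raw by (simp add: form_def lin_def)

lemma form_comp: "form g \<Longrightarrow> lin f \<Longrightarrow> form (\<lambda>x. g (f x))"
  by (simp add: form_def lin_def)

lemma form_mult_right [lin_intros]: "form f \<Longrightarrow> form (\<lambda>x. f x * c)"
  and form_mult_left [lin_intros]: "form f \<Longrightarrow> form (\<lambda>x. c * f x)"
  by (simp_all add: form_def algebra_simps)

lemma lin_sw_inside [lin_intros]:
  assumes "\<And>u v. lin (\<lambda>x. F x u v)"
  shows "lin (\<lambda>x. sw a (F x))"
  using assms unfolding sw_def case_prod_unfold by (intro lin_sum_list_fun) auto

lemma sw_cong_tensor_eq:
  assumes eq: "tensor_eq scale [[x, y]. (x, y) \<leftarrow> s] [[x, y]. (x, y) \<leftarrow> t]"
    and F: "\<And>y. lin (\<lambda>x. F x y)" "\<And>x. lin (F x)"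
  shows "(\<Sum>(x, y)\<leftarrow>s. F x y) = (\<Sum>(x, y)\<leftarrow>t. F x y)"
proof -
  define L where "L w = (if length w = 2 then F (w ! 0) (w ! 1) else 0)" for w :: "'h list"
  have add: "L (u @ (x + y) # v) = L (u @ x # v) + L (u @ y # v)" for u x y v
    using lin_add[OF F(1)] lin_add[OF F(2)]
    by (cases u; cases "tl u"; cases v) (auto simp: L_def)
  have sc: "L (u @ scale c x # v) = scale c (L (u @ x # v))" for u c x v
    using lin_scale[OF F(1)] lin_scale[OF F(2)]
    by (cases u; cases "tl u"; cases v) (auto simp: L_def)
  have L2: "L [x, y] = F x y" for x y
    by (simp add: L_def)
  from sum_list_tensor_eq[of L, OF add sc eq] show ?thesis
    by (simp add: L2 o_def case_prod_unfold)
qed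

lemma sw_cong_tensor_eq3:
  assumes eq: "tensor_eq scale s t"
    and len: "\<And>w. w \<in> set s \<union> set t \<Longrightarrow> length w = 3"
    and F: "\<And>y z. lin (\<lambda>x. F x y z)" "\<And>x z. lin (\<lambda>y. F x y z)" "\<And>x y. lin (\<lambda>z. F x y z)"
  shows "(\<Sum>w\<leftarrow>s. F (w ! 0) (w ! 1) (w ! 2)) = (\<Sum>w\<leftarrow>t. F (w ! 0) (w ! 1) (w ! 2))"
proof -
  define L where "L w = (if length w = 3 then F (w ! 0) (w ! 1) (w ! 2) else 0)" for w :: "'h list"
  have add: "L (u @ (x + y) # v) = L (u @ x # v) + L (u @ y # v)" for u x y v
    using lin_add[OF F(1)] lin_add[OF F(2)] lin_add[OF F(3)]
    by (cases u; cases "tl u"; cases "tl (tl u)"; cases v; cases "tl v")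
      (auto simp: L_def numeral_2_eq_2 numeral_3_eq_3)
  have sc: "L (u @ scale c x # v) = scale c (L (u @ x # v))" for u c x v
    using lin_scale[OF F(1)] lin_scale[OF F(2)] lin_scale[OF F(3)]
    by (cases u; cases "tl u"; cases "tl (tl u)"; cases v; cases "tl v")
      (auto simp: L_def numeral_2_eq_2 numeral_3_eq_3)
  have "(\<Sum>w\<leftarrow>s. L w) = (\<Sum>w\<leftarrow>t. L w)"
    using sum_list_tensor_eq[of L, OF add sc eq] .
  moreover have "(\<Sum>w\<leftarrow>s. L w) = (\<Sum>w\<leftarrow>s. F (w ! 0) (w ! 1) (w ! 2))"
    "(\<Sum>w\<leftarrow>t. L w) = (\<Sum>w\<leftarrow>t. F (w ! 0) (w ! 1) (w ! 2))"
    using len by (auto simp: L_def intro!: arg_cong[of _ _ sum_list] map_cong)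
  ultimately show ?thesis by simp
qed

lemma sum_list_pairs: "(\<Sum>w\<leftarrow>concat (map (\<lambda>p. map (f p) (g p)) xs). h w) =
    (\<Sum>p\<leftarrow>xs. \<Sum>q\<leftarrow>g p. h (f p q))"
  by (induction xs) (auto simp: o_def)

lemma sw_add:
  assumes "\<And>y. lin (\<lambda>x. F x y)" "\<And>x. lin (F x)"
  shows "sw (a + b) F = sw a F + sw b F"
  unfolding sw_def using sw_cong_tensor_eq[OF \<Delta>_add assms] by simp

lemma sw_scale:
  assumes "\<And>y. lin (\<lambda>x. F x y)" "\<And>x. lin (F x)"
  shows "sw (scale c a) F = scale c (sw a F)"
proof -
  have "tensor_eq scale [[x, y]. (x, y) \<leftarrow> \<Delta> (scale c a)]
      [[x, y]. (x, y) \<leftarrow> map (\<lambda>(x, y). (scale c x, y)) (\<Delta> a)]"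
    using \<Delta>_scale[of c a] by (simp add: o_def case_prod_unfold)
  from sw_cong_tensor_eq[OF this assms]
  have "sw (scale c a) F = sw a (\<lambda>x y. scale c (F x y))"
    unfolding sw_def by (simp add: o_def case_prod_unfold lin_scale[OF assms(1)])
  also have "\<dots> = scale c (sw a F)"
    by (rule lin_sw[symmetric]) (intro lin_intros)
  finally show ?thesis .
qed

lemma lin_sw_outside [lin_intros]:
  assumes "lin f" "\<And>y. lin (\<lambda>x. F x y)" "\<And>x. lin (F x)"
  shows "lin (\<lambda>x. sw (f x) F)"
  using assms(1) sw_add[OF assms(2,3)] sw_scale[OF assms(2,3)] by (simp add: lin_def)

lemma sw_one:
  assumes "\<And>y. lin (\<lambda>x. F x y)" "\<And>x. lin (F x)"
  shows "sw 1 F = F 1 1"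
proof -
  have "tensor_eq scale [[x, y]. (x, y) \<leftarrow> \<Delta> 1] [[x, y]. (x, y) \<leftarrow> [(1, 1)]]"
    using \<Delta>_one by simp
  from sw_cong_tensor_eq[OF this assms] show ?thesis by (simp add: sw_def)
qed

lemma sw_mult:
  assumes "\<And>y. lin (\<lambda>x. F x y)" "\<And>x. lin (F x)"
  shows "sw (a * b) F = sw a (\<lambda>x y. sw b (\<lambda>u v. F (x * u) (y * v)))"
proof -
  have "tensor_eq scale [[x, y]. (x, y) \<leftarrow> \<Delta> (a * b)]
      [[x, y]. (x, y) \<leftarrow> [(x * u, y * v). (x, y) \<leftarrow> \<Delta> a, (u, v) \<leftarrow> \<Delta> b]]"
    using \<Delta>_mult[of a b] by (simp add: o_def case_prod_unfold map_concat)
  from sw_cong_tensor_eq[OF this assms] show ?thesis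
    by (simp add: sw_def case_prod_unfold sum_list_pairs)
qed

lemma sw_coassoc:
  assumes "\<And>y z. lin (\<lambda>x. F x y z)" "\<And>x z. lin (\<lambda>y. F x y z)" "\<And>x y. lin (\<lambda>z. F x y z)"
  shows "sw a (\<lambda>x z. sw x (\<lambda>x y. F x y z)) = sw a (\<lambda>x z. sw z (\<lambda>y z. F x y z))"
  using sw_cong_tensor_eq3[OF coassoc[of a] _ assms]
  by (simp add: sw_def case_prod_unfold sum_list_pairs) fastforce

lemma sw_counit_left:
  assumes "lin f" shows "sw a (\<lambda>x y. scale (\<epsilon> x) (f y)) = f a"
proof -
  have "sw a (\<lambda>x y. scale (\<epsilon> x) (f y)) = f (sw a (\<lambda>x y. scale (\<epsilon> x) y))"
    using assms by (simp add: lin_sw lin_scale)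
  then show ?thesis by (simp add: sw_def counit_left)
qed

lemma sw_counit_right:
  assumes "lin f" shows "sw a (\<lambda>x y. scale (\<epsilon> y) (f x)) = f a"
proof -
  have "sw a (\<lambda>x y. scale (\<epsilon> y) (f x)) = f (sw a (\<lambda>x y. scale (\<epsilon> y) x))"
    using assms by (simp add: lin_sw lin_scale)
  then show ?thesis by (simp add: sw_def counit_right)
qed

lemma sw_antipode_left: "sw a (\<lambda>x y. S x * y) = scale (\<epsilon> a) 1"
  and sw_antipode_right: "sw a (\<lambda>x y. x * S y) = scale (\<epsilon> a) 1"
  by (simp_all add: sw_def antipode_left antipode_right)

lemma sum_list_swap:
  fixes F :: "'x \<Rightarrow> 'y \<Rightarrow> 'h"
  shows "(\<Sum>p\<leftarrow>xs. \<Sum>q\<leftarrow>ys. F p q) = (\<Sum>q\<leftarrow>ys. \<Sum>p\<leftarrow>xs. F p q)"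
  by (induction xs) (simp_all add: sum_list_addf)

lemma sw_swap: "sw a (\<lambda>x y. sw b (\<lambda>u v. F x y u v)) = sw b (\<lambda>u v. sw a (\<lambda>x y. F x y u v))"
  unfolding sw_def case_prod_unfold by (rule sum_list_swap)

lemma sw_sum: "(\<Sum>i\<in>A. sw a (\<lambda>x y. F i x y)) = sw a (\<lambda>x y. \<Sum>i\<in>A. F i x y)"
proof -
  have "(\<Sum>i\<in>A. \<Sum>p\<leftarrow>ps. G i p) = (\<Sum>p\<leftarrow>ps. \<Sum>i\<in>A. G i p)"
    for ps :: "('h \<times> 'h) list" and G :: "_ \<Rightarrow> _ \<Rightarrow> 'h"
    by (induction ps) (simp_all add: sum.distrib)
  then show ?thesis by (simp add: sw_def case_prod_unfold)
qed

lemma sw_sum_list: "(\<Sum>i\<leftarrow>xs. sw a (\<lambda>x y. F i x y)) = sw a (\<lambda>x y. \<Sum>i\<leftarrow>xs. F i x y)"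
  unfolding sw_def case_prod_unfold by (induction xs) (simp_all add: sum_list_addf)

lemma sw_in_subspace:
  assumes "subspace N" "\<And>x y. F x y \<in> N" shows "sw a F \<in> N"
proof -
  have "(\<Sum>p\<leftarrow>ps. G p) \<in> N" if "\<And>p. G p \<in> N" for ps :: "('h \<times> 'h) list" and G
    using that assms(1) by (induction ps) (auto intro: subspace_0 subspace_add)
  then show ?thesis using assms(2) by (simp add: sw_def case_prod_unfold)
qed

lemma lin_comp: "lin f \<Longrightarrow> lin g \<Longrightarrow> lin (\<lambda>x. f (g x))"
  by (simp add: lin_def)

lemma sw_cancel_first:
  assumes "lin G" and "\<And>u z. sw u (\<lambda>x y. F x y z) = scale (\<epsilon> u) (G z)"
  shows "sw a (\<lambda>x z. sw x (\<lambda>x y. F x y z)) = G a"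
  using assms by (simp add: sw_counit_left)

lemma sw_cancel_last:
  assumes "\<And>y z. lin (\<lambda>x. F x y z)" "\<And>x z. lin (\<lambda>y. F x y z)" "\<And>x y. lin (\<lambda>z. F x y z)"
    and "lin G" and "\<And>u x. sw u (\<lambda>y z. F x y z) = scale (\<epsilon> u) (G x)"
  shows "sw a (\<lambda>x z. sw x (\<lambda>x y. F x y z)) = G a"
  using assms by (simp add: sw_coassoc sw_counit_right)

text \<open>
  Both sides are \<open>\<Sum> F(a\<^sub>1, a\<^sub>2, a\<^sub>3, a\<^sub>4)\<close>, bracketed once as two pairs and once around the middle pair.
\<close>

lemma sw_middle:
  assumes lin: "\<And>y z w. lin (\<lambda>x. F x y z w)" "\<And>x z w. lin (\<lambda>y. F x y z w)"
      "\<And>x y w. lin (\<lambda>z. F x y z w)" "\<And>x y z. lin (\<lambda>w. F x y z w)"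
  shows "sw a (\<lambda>u v. sw u (\<lambda>x y. sw v (\<lambda>z w. F x y z w))) =
      sw a (\<lambda>x u. sw u (\<lambda>v w. sw v (\<lambda>y z. F x y z w)))"
proof -
  have "sw a (\<lambda>u v. sw u (\<lambda>x y. sw v (\<lambda>z w. F x y z w))) =
      sw a (\<lambda>x u. sw u (\<lambda>y v. sw v (\<lambda>z w. F x y z w)))"
    by (rule sw_coassoc) (intro lin lin_intros)+
  moreover have "sw u (\<lambda>y v. sw v (\<lambda>z w. F x y z w)) = sw u (\<lambda>v w. sw v (\<lambda>y z. F x y z w))" for u x
    by (rule sw_coassoc[symmetric]) (intro lin)+
  ultimately show ?thesis by simp
qed

text \<open>
  In a product of two factors that both contain legs of \<open>a\<close>, the letters in the middle that come from
  \<open>a\<close> meet as \<open>S(a\<^sub>2)a\<^sub>3\<close> and cancel, as \<open>a\<^sup>-\<^sup>1a\<close> does in a group. All commutator identities below come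
  from group identities by this rule.
\<close>

lemma sw_cancel_middle:
  assumes lin: "\<And>y z w. lin (\<lambda>x. F x y z w)" "\<And>x z w. lin (\<lambda>y. F x y z w)"
      "\<And>x y w. lin (\<lambda>z. F x y z w)" "\<And>x y z. lin (\<lambda>w. F x y z w)"
    and G: "\<And>x. lin (G x)" and cancel: "\<And>u x w. sw u (\<lambda>y z. F x y z w) = scale (\<epsilon> u) (G x w)"
  shows "sw a (\<lambda>u v. sw u (\<lambda>x y. sw v (\<lambda>z w. F x y z w))) = sw a G"
  unfolding sw_middle[OF lin] by (simp add: sw_cancel_first[OF G cancel])

lemma sw_antipode_left_lin:
  assumes "lin G" shows "sw a (\<lambda>x y. G (S x * y)) = scale (\<epsilon> a) (G 1)"
  using lin_sw[OF assms, of a "\<lambda>x y. S x * y"] by (simp add: sw_antipode_left lin_scale[OF assms])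

lemma sw_antipode_right_lin:
  assumes "lin G" shows "sw a (\<lambda>x y. G (x * S y)) = scale (\<epsilon> a) (G 1)"
  using lin_sw[OF assms, of a "\<lambda>x y. x * S y"] by (simp add: sw_antipode_right lin_scale[OF assms])

section \<open>The antipode\<close>

lemma S_one: "S 1 = 1"
  using sw_antipode_left[of 1] by (subst (asm) sw_one) (auto simp: \<epsilon>_one intro!: lin_intros)

text \<open>
  Elements of the field are compared as multiples of \<open>1\<close>, so that only sums in \<open>'h\<close> occur.
\<close>

lemma eps_S: "\<epsilon> (S a) = \<epsilon> a"
proof -
  have lin: "lin (\<lambda>x. scale (\<epsilon> x) 1)"
    by (intro lin_intros)
  have "scale (\<epsilon> (S a)) 1 = sw a (\<lambda>x y. scale (\<epsilon> y) (scale (\<epsilon> (S x)) 1))"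
    by (rule sw_counit_right[symmetric]) (intro lin_intros)
  also have "\<dots> = sw a (\<lambda>x y. scale (\<epsilon> (S x * y)) 1)"
    by (simp add: \<epsilon>_mult mult.commute)
  also have "\<dots> = scale (\<epsilon> a) 1"
    by (subst sw_antipode_left_lin[OF lin]) (simp add: \<epsilon>_one)
  finally show ?thesis by simp
qed

text \<open>
  The sum \<open>\<Sum> S(a\<^sub>1b\<^sub>1) a\<^sub>2b\<^sub>2 S(b\<^sub>3)S(a\<^sub>3)\<close> collapses to \<open>S(ab)\<close> when the right-hand pairs are
  contracted first and to \<open>S(b)S(a)\<close> when the first two factors are: the multiplication has a left and
  a right convolution inverse, which agree.
\<close>

lemma S_mult: "S (a * b) = S b * S a"
proof -
  \<comment> \<open>\<open>x, y, z\<close> are the legs of \<open>a\<close> and \<open>u, v, w\<close> those of \<open>b\<close>.\<close>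
  define F where "F x y z u v w = S (x * u) * (y * (v * S w) * S z)" for x y z u v w
  have F: "lin (\<lambda>x. F x y z u v w)" "lin (\<lambda>y. F x y z u v w)" "lin (\<lambda>z. F x y z u v w)"
    "lin (\<lambda>u. F x y z u v w)" "lin (\<lambda>v. F x y z u v w)" "lin (\<lambda>w. F x y z u v w)" for x y z u v w
    unfolding F_def by (intro lin_intros)+
  define T where "T x y z = sw b (\<lambda>s w. sw s (\<lambda>u v. F x y z u v w))" for x y z
  have T: "lin (\<lambda>x. T x y z)" "lin (\<lambda>y. T x y z)" "lin (\<lambda>z. T x y z)" for x y z
    unfolding T_def by (intro lin_intros F)+
  have T1: "T x y z = S (x * b) * (y * S z)" for x y z
    unfolding T_def
  proof (rule sw_cancel_last)
    fix m u
    have "lin (\<lambda>p. S (x * u) * (y * p * S z))"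
      by (intro lin_intros)
    from sw_antipode_right_lin[OF this]
    show "sw m (\<lambda>v w. F x y z u v w) = scale (\<epsilon> m) (S (x * u) * (y * S z))"
      by (simp add: F_def)
  qed (intro lin_intros F)+
  have "sw a (\<lambda>s z. sw s (\<lambda>x y. T x y z)) = S (a * b)"
  proof (rule sw_cancel_last)
    fix m x
    have "lin (\<lambda>p. S (x * b) * p)"
      by (intro lin_intros)
    from sw_antipode_right_lin[OF this]
    show "sw m (\<lambda>y z. T x y z) = scale (\<epsilon> m) (S (x * b))"
      by (simp add: T1)
  qed (intro lin_intros T)+
  moreover have "sw a (\<lambda>s z. sw s (\<lambda>x y. T x y z)) = S b * S a"
  proof (rule sw_cancel_first)
    fix m z
    have "sw m (\<lambda>x y. T x y z) = sw b (\<lambda>s w. sw m (\<lambda>x y. sw s (\<lambda>u v. F x y z u v w)))"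
      unfolding T_def by (rule sw_swap)
    also have "\<dots> = sw b (\<lambda>s w. sw (m * s) (\<lambda>p q. S p * q * (S w * S z)))"
      by (subst sw_mult) (auto simp: F_def mult.assoc intro!: lin_intros)
    also have "\<dots> = sw b (\<lambda>s w. scale (\<epsilon> (m * s)) (S w * S z))"
      by (subst sw_antipode_left_lin) (auto intro!: lin_intros)
    also have "\<dots> = sw b (\<lambda>s w. scale (\<epsilon> s) (scale (\<epsilon> m) (S w * S z)))"
      by (simp add: \<epsilon>_mult mult.commute)
    also have "\<dots> = scale (\<epsilon> m) (S b * S z)"
      by (rule sw_counit_left) (intro lin_intros)
    finally show "sw m (\<lambda>x y. T x y z) = scale (\<epsilon> m) (S b * S z)" .
  qed (intro lin_intros)
  ultimately show ?thesis by simp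
qed

text \<open>
  The antipode reverses the comultiplication, for the same reason: \<open>\<Delta> \<circ> S\<close> is a left and
  \<open>a \<mapsto> \<Sum> S(a\<^sub>2) \<otimes> S(a\<^sub>1)\<close> a right convolution inverse of \<open>\<Delta>\<close>.
\<close>

lemma sw_S:
  assumes B1: "\<And>y. lin (\<lambda>x. B x y)" and B2: "\<And>x. lin (B x)"
  shows "sw (S a) B = sw a (\<lambda>x y. B (S y) (S x))"
proof -
  have B: "lin g \<Longrightarrow> lin (\<lambda>x. B (g x) y)" "lin g \<Longrightarrow> lin (\<lambda>x. B y (g x))" for g y
    using lin_comp[OF B1, of g] lin_comp[OF B2, of g] by auto
  \<comment> \<open>The sum is \<open>\<Sum> \<Delta>(S(a\<^sub>1)y) \<cdot> (S(a\<^sub>5) \<otimes> S(a\<^sub>4))\<close>, where \<open>\<Delta> y = \<Sum> a\<^sub>2 \<otimes> a\<^sub>3\<close>.\<close>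
  define F where "F x y z = sw (S x * y) (\<lambda>p q. sw z (\<lambda>u v. B (p * S v) (q * S u)))" for x y z
  have F: "lin (\<lambda>x. F x y z)" "lin (\<lambda>y. F x y z)" "lin (\<lambda>z. F x y z)" for x y z
    unfolding F_def by (intro lin_intros B)+
  have "sw a (\<lambda>s z. sw s (\<lambda>x y. F x y z)) = sw a (\<lambda>u v. B (S v) (S u))"
  proof (rule sw_cancel_first)
    fix m z
    have "lin (\<lambda>t. sw t (\<lambda>p q. sw z (\<lambda>u v. B (p * S v) (q * S u))))"
      by (intro lin_intros B)
    from sw_antipode_left_lin[OF this]
    have "sw m (\<lambda>x y. F x y z) =
        scale (\<epsilon> m) (sw 1 (\<lambda>p q. sw z (\<lambda>u v. B (p * S v) (q * S u))))"
      by (simp add: F_def)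
    also have "sw 1 (\<lambda>p q. sw z (\<lambda>u v. B (p * S v) (q * S u))) = sw z (\<lambda>u v. B (S v) (S u))"
      by (subst sw_one) (auto intro!: lin_intros B)
    finally show "sw m (\<lambda>x y. F x y z) = scale (\<epsilon> m) (sw z (\<lambda>u v. B (S v) (S u)))" .
  qed (intro lin_intros B)
  moreover have "sw a (\<lambda>s z. sw s (\<lambda>x y. F x y z)) = sw (S a) B"
  proof (rule sw_cancel_last)
    fix m x
    have "F x y z = sw (S x) (\<lambda>s t. sw y (\<lambda>u p. sw z (\<lambda>q v. B (s * u * S v) (t * p * S q))))" for y z
      unfolding F_def by (subst sw_mult) (auto intro!: lin_intros B)
    then have "sw m (\<lambda>y z. F x y z) =
        sw (S x) (\<lambda>s t. sw m (\<lambda>y z. sw y (\<lambda>u p. sw z (\<lambda>q v. B (s * u * S v) (t * p * S q)))))"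
      by (simp add: sw_swap[of m])
    also have "\<dots> = sw (S x) (\<lambda>s t. sw m (\<lambda>u v. B (s * (u * S v)) t))"
    proof (rule arg_cong[of _ _ "sw (S x)"], intro ext, rule sw_cancel_middle)
      fix s t n u v
      have "lin (\<lambda>k. B (s * (u * S v)) (t * k))"
        by (intro lin_intros B)
      from sw_antipode_right_lin[OF this]
      show "sw n (\<lambda>p q. B (s * u * S v) (t * p * S q)) = scale (\<epsilon> n) (B (s * (u * S v)) t)"
        by (simp add: mult.assoc)
    qed (intro lin_intros B)+
    also have "\<dots> = sw (S x) (\<lambda>s t. scale (\<epsilon> m) (B s t))"
      by (subst sw_antipode_right_lin) (auto intro!: lin_intros B)
    also have "\<dots> = scale (\<epsilon> m) (sw (S x) B)"
      by (rule lin_sw[symmetric]) (intro lin_intros)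
    finally show "sw m (\<lambda>y z. F x y z) = scale (\<epsilon> m) (sw (S x) B)" .
  qed (intro lin_intros F B1 B2)+
  ultimately show ?thesis by simp
qed

section \<open>Commutators\<close>

definition comm :: "'h \<Rightarrow> 'h \<Rightarrow> 'h"
  where "comm a b = sw a (\<lambda>x y. sw b (\<lambda>u v. x * u * S y * S v))"

definition ad :: "'h \<Rightarrow> 'h \<Rightarrow> 'h"
  where "ad h x = sw h (\<lambda>u v. u * x * S v)"

lemma commutator_two_comm: "commutator [a, b] = comm a b"
  by (simp add: commutator_two comm_def sw_def)

lemma comm_swap: "comm a b = sw b (\<lambda>u v. sw a (\<lambda>x y. x * u * S y * S v))"
  unfolding comm_def by (rule sw_swap)

lemma lin_comm_left [lin_intros]: "lin f \<Longrightarrow> lin (\<lambda>x. comm (f x) b)"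
  and lin_comm_right [lin_intros]: "lin f \<Longrightarrow> lin (\<lambda>x. comm a (f x))"
  unfolding comm_def by (intro lin_intros; assumption)+

lemma lin_ad [lin_intros]: "lin f \<Longrightarrow> lin (\<lambda>x. ad h (f x))"
  unfolding ad_def by (intro lin_intros; assumption)

lemma comm_eps: "\<epsilon> (comm a b) = \<epsilon> a * \<epsilon> b"
proof -
  have lin: "lin (\<lambda>x. scale (\<epsilon> x) 1)"
    by (intro lin_intros)
  have "scale (\<epsilon> (comm a b)) 1 = sw a (\<lambda>x y. sw b (\<lambda>u v. scale (\<epsilon> (x * u * S y * S v)) 1))"
    unfolding comm_def by (simp add: lin_sw[OF lin])
  also have "\<dots> = sw a (\<lambda>x y. scale (\<epsilon> y) (sw b (\<lambda>u v. scale (\<epsilon> v) (scale (\<epsilon> x * \<epsilon> u) 1))))"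
    by (subst lin_sw, intro lin_intros) (simp add: \<epsilon>_mult eps_S ac_simps)
  also have "\<dots> = sw b (\<lambda>u v. scale (\<epsilon> v) (scale (\<epsilon> a * \<epsilon> u) 1))"
    by (rule sw_counit_right) (intro lin_intros form_eps)
  also have "\<dots> = scale (\<epsilon> a * \<epsilon> b) 1"
    by (rule sw_counit_right) (intro lin_intros)
  finally show ?thesis by simp
qed

text \<open>
  The Hopf form of \<open>ab = [a,b]ba\<close>.
\<close>

lemma comm_reorder: "a * b = sw a (\<lambda>x y. sw b (\<lambda>u v. comm x u * (v * y)))"
proof -
  have "sw b (\<lambda>u v. comm x u * (v * y)) = sw x (\<lambda>p q. p * b * S q * y)" for x y
  proof -
    have "comm x u * (v * y) = sw u (\<lambda>r s. sw x (\<lambda>p q. p * r * S q * (S s * v) * y))" for u v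
      unfolding comm_swap
      by (subst lin_sw[of "\<lambda>t. t * (v * y)"], intro lin_intros)+ (simp add: mult.assoc)
    then have "sw b (\<lambda>u v. comm x u * (v * y)) =
        sw b (\<lambda>u v. sw u (\<lambda>r s. sw x (\<lambda>p q. p * r * S q * (S s * v) * y)))"
      by simp
    also have "\<dots> = sw x (\<lambda>p q. p * b * S q * y)"
    proof (rule sw_cancel_last)
      fix n r
      have "lin (\<lambda>t. sw x (\<lambda>p q. p * r * S q * t * y))"
        by (intro lin_intros)
      from sw_antipode_left_lin[OF this]
      show "sw n (\<lambda>s v. sw x (\<lambda>p q. p * r * S q * (S s * v) * y)) =
          scale (\<epsilon> n) (sw x (\<lambda>p q. p * r * S q * y))" by simp
    qed (intro lin_intros)+
    finally show ?thesis .
  qed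
  moreover have "sw a (\<lambda>x y. sw x (\<lambda>p q. p * b * S q * y)) = a * b"
  proof (rule sw_cancel_last)
    fix n p
    have "lin (\<lambda>t. p * b * t)"
      by (intro lin_intros)
    from sw_antipode_left_lin[OF this]
    show "sw n (\<lambda>q y. p * b * S q * y) = scale (\<epsilon> n) (p * b)" by (simp add: mult.assoc)
  qed (intro lin_intros)+
  ultimately show ?thesis by simp
qed

text \<open>
  The Hopf form of \<open>h[a,b]h\<^sup>-\<^sup>1 = [ha,b][b,h]\<close>. The more obvious \<open>[hah\<^sup>-\<^sup>1, hbh\<^sup>-\<^sup>1]\<close> has no such form: the
  adjoint action respects \<open>\<Delta>\<close> only if \<open>H\<close> is cocommutative.
\<close>

lemma ad_comm: "ad h (comm a b) = sw h (\<lambda>x y. sw b (\<lambda>u v. comm (x * a) u * comm v y))"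
proof -
  have "sw b (\<lambda>u v. comm (x * a) u * comm v y) =
      sw b (\<lambda>r s. sw (x * a) (\<lambda>p q. sw y (\<lambda>k l. p * r * S q * k * S s * S l)))" for x y
  proof -
    have "comm (x * a) u * comm v y = sw u (\<lambda>r s. sw v (\<lambda>m n.
        sw (x * a) (\<lambda>p q. sw y (\<lambda>k l. p * r * S q * (S s * m) * k * S n * S l))))" for u v
    proof -
      have "comm (x * a) u * comm v y =
          sw u (\<lambda>r s. sw (x * a) (\<lambda>p q. p * r * S q * S s * comm v y))"
        unfolding comm_swap[of "x * a"] by (subst lin_sw[of "\<lambda>t. t * comm v y"], intro lin_intros)+ simp
      also have "\<dots> = sw u (\<lambda>r s. sw (x * a) (\<lambda>p q. sw v (\<lambda>m n. sw y (\<lambda>k l.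
          p * r * S q * (S s * m) * k * S n * S l))))"
        unfolding comm_def
        by (subst lin_sw[of "\<lambda>t. _ * t"], intro lin_intros)+ (simp add: mult.assoc)
      finally show ?thesis by (simp add: sw_swap[of "x * a"])
    qed
    then have "sw b (\<lambda>u v. comm (x * a) u * comm v y) = sw b (\<lambda>u v. sw u (\<lambda>r s. sw v (\<lambda>m n.
        sw (x * a) (\<lambda>p q. sw y (\<lambda>k l. p * r * S q * (S s * m) * k * S n * S l)))))"
      by simp
    also have "\<dots> = sw b (\<lambda>r s. sw (x * a) (\<lambda>p q. sw y (\<lambda>k l. p * r * S q * k * S s * S l)))"
    proof (rule sw_cancel_middle)
      fix c r n
      have "lin (\<lambda>t. sw (x * a) (\<lambda>p q. sw y (\<lambda>k l. p * r * S q * t * k * S n * S l)))"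
        by (intro lin_intros)
      from sw_antipode_left_lin[OF this]
      show "sw c (\<lambda>s m. sw (x * a) (\<lambda>p q. sw y (\<lambda>k l. p * r * S q * (S s * m) * k * S n * S l))) =
          scale (\<epsilon> c) (sw (x * a) (\<lambda>p q. sw y (\<lambda>k l. p * r * S q * k * S n * S l)))" by simp
    qed (intro lin_intros)+
    finally show ?thesis .
  qed
  then have "sw h (\<lambda>x y. sw b (\<lambda>u v. comm (x * a) u * comm v y)) =
      sw b (\<lambda>r s. sw h (\<lambda>x y. sw (x * a) (\<lambda>p q. sw y (\<lambda>k l. p * r * S q * k * S s * S l))))"
    by (simp add: sw_swap[of h])
  also have "\<dots> = sw b (\<lambda>r s. sw h (\<lambda>p l. sw a (\<lambda>m n. p * m * r * S n * S s * S l)))"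
  proof (rule arg_cong[of _ _ "sw b"], intro ext)
    fix r s
    have "sw (x * a) (\<lambda>p q. sw y (\<lambda>k l. p * r * S q * k * S s * S l)) =
        sw x (\<lambda>p q. sw y (\<lambda>k l. sw a (\<lambda>m n. p * m * r * S n * (S q * k) * S s * S l)))" for x y
      by (subst sw_mult, (intro lin_intros)+) (simp add: S_mult mult.assoc sw_swap[of a])
    then have "sw h (\<lambda>x y. sw (x * a) (\<lambda>p q. sw y (\<lambda>k l. p * r * S q * k * S s * S l))) =
        sw h (\<lambda>x y. sw x (\<lambda>p q. sw y (\<lambda>k l. sw a (\<lambda>m n. p * m * r * S n * (S q * k) * S s * S l))))"
      by simp
    also have "\<dots> = sw h (\<lambda>p l. sw a (\<lambda>m n. p * m * r * S n * S s * S l))"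
    proof (rule sw_cancel_middle)
      fix c p l
      have "lin (\<lambda>t. sw a (\<lambda>m n. p * m * r * S n * t * S s * S l))"
        by (intro lin_intros)
      from sw_antipode_left_lin[OF this]
      show "sw c (\<lambda>q k. sw a (\<lambda>m n. p * m * r * S n * (S q * k) * S s * S l)) =
          scale (\<epsilon> c) (sw a (\<lambda>m n. p * m * r * S n * S s * S l))" by simp
    qed (intro lin_intros)+
    finally show "sw h (\<lambda>x y. sw (x * a) (\<lambda>p q. sw y (\<lambda>k l. p * r * S q * k * S s * S l))) =
        sw h (\<lambda>p l. sw a (\<lambda>m n. p * m * r * S n * S s * S l))" .
  qed
  also have "\<dots> = sw h (\<lambda>p l. sw b (\<lambda>r s. sw a (\<lambda>m n. p * m * r * S n * S s * S l)))"
    by (rule sw_swap)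
  also have "\<dots> = ad h (comm a b)"
    unfolding ad_def comm_swap
    by (subst lin_sw[of "\<lambda>t. _ * t * _"], intro lin_intros)+ (simp add: mult.assoc)
  finally show ?thesis ..
qed

text \<open>
  The Hopf form of \<open>ab c a\<^sup>-\<^sup>1b\<^sup>-\<^sup>1 d = [a,b] (ba) c (ba)\<^sup>-\<^sup>1 d\<close>. For \<open>c\<close> and \<open>d\<close> the products of the
  remaining legs of a long commutator are substituted.
\<close>

lemma comm_split:
  "sw a (\<lambda>x y. sw b (\<lambda>u v. x * u * c * S y * S v * d)) =
   sw a (\<lambda>x y. sw b (\<lambda>u v. comm x u * sw (v * y) (\<lambda>p q. p * c * S q * d)))"
proof -
  have "sw b (\<lambda>u v. comm x u * sw (v * y) (\<lambda>p q. p * c * S q * d)) =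
      sw b (\<lambda>r s. sw x (\<lambda>p q. sw y (\<lambda>k l. p * r * (S q * k) * c * S l * S s * d)))" for x y
  proof -
    have "comm x u * sw (v * y) (\<lambda>p q. p * c * S q * d) = sw u (\<lambda>r s. sw v (\<lambda>m n.
        sw x (\<lambda>p q. sw y (\<lambda>k l. p * r * S q * (S s * m) * k * c * S l * S n * d))))" for u v
    proof -
      have "comm x u * sw (v * y) (\<lambda>p q. p * c * S q * d) =
          sw u (\<lambda>r s. sw x (\<lambda>p q. p * r * S q * S s * sw (v * y) (\<lambda>p q. p * c * S q * d)))"
        unfolding comm_swap
        by (subst lin_sw[of "\<lambda>t. t * sw (v * y) (\<lambda>p q. p * c * S q * d)"], intro lin_intros)+ simp
      also have "\<dots> = sw u (\<lambda>r s. sw x (\<lambda>p q. sw v (\<lambda>m n. sw y (\<lambda>k l.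
          p * r * S q * (S s * m) * k * c * S l * S n * d))))"
        by (subst sw_mult, (intro lin_intros)+, (subst lin_sw[of "\<lambda>t. _ * t"], intro lin_intros)+)
          (simp add: mult.assoc S_mult)
      finally show ?thesis by (simp add: sw_swap[of x])
    qed
    then have "sw b (\<lambda>u v. comm x u * sw (v * y) (\<lambda>p q. p * c * S q * d)) =
        sw b (\<lambda>u v. sw u (\<lambda>r s. sw v (\<lambda>m n.
          sw x (\<lambda>p q. sw y (\<lambda>k l. p * r * S q * (S s * m) * k * c * S l * S n * d)))))"
      by simp
    also have "\<dots> = sw b (\<lambda>r s. sw x (\<lambda>p q. sw y (\<lambda>k l. p * r * (S q * k) * c * S l * S s * d)))"
    proof (rule sw_cancel_middle)
      fix e r n
      have "lin (\<lambda>t. sw x (\<lambda>p q. sw y (\<lambda>k l. p * r * S q * t * k * c * S l * S n * d)))"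
        by (intro lin_intros)
      from sw_antipode_left_lin[OF this]
      show "sw e (\<lambda>s m. sw x (\<lambda>p q. sw y (\<lambda>k l. p * r * S q * (S s * m) * k * c * S l * S n * d))) =
          scale (\<epsilon> e) (sw x (\<lambda>p q. sw y (\<lambda>k l. p * r * (S q * k) * c * S l * S n * d)))"
        by (simp add: mult.assoc)
    qed (intro lin_intros)+
    finally show ?thesis .
  qed
  then have "sw a (\<lambda>x y. sw b (\<lambda>u v. comm x u * sw (v * y) (\<lambda>p q. p * c * S q * d))) =
      sw b (\<lambda>r s. sw a (\<lambda>x y. sw x (\<lambda>p q. sw y (\<lambda>k l. p * r * (S q * k) * c * S l * S s * d))))"
    by (simp add: sw_swap[of a])
  also have "\<dots> = sw b (\<lambda>r s. sw a (\<lambda>p l. p * r * c * S l * S s * d))"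
  proof (rule arg_cong[of _ _ "sw b"], intro ext, rule sw_cancel_middle)
    fix r s e p l
    have "lin (\<lambda>t. p * r * t * c * S l * S s * d)"
      by (intro lin_intros)
    from sw_antipode_left_lin[OF this]
    show "sw e (\<lambda>q k. p * r * (S q * k) * c * S l * S s * d) =
        scale (\<epsilon> e) (p * r * c * S l * S s * d)" by simp
  qed (intro lin_intros)+
  also have "\<dots> = sw a (\<lambda>p l. sw b (\<lambda>r s. p * r * c * S l * S s * d))"
    by (rule sw_swap)
  finally show ?thesis ..
qed

lemma sum_list_product_lists_Cons:
  "(\<Sum>ps\<leftarrow>product_lists (map \<Delta> (a # as)). F ps) =
   (\<Sum>ps\<leftarrow>product_lists (map \<Delta> as). sw a (\<lambda>x y. F ((x, y) # ps)))"
  unfolding sw_def case_prod_unfold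
  by (subst sum_list_swap) (simp add: map_concat sum_list_concat_map o_def)

lemma commutator_Cons_Cons:
  "commutator (a # b # as) = sw a (\<lambda>x y. sw b (\<lambda>u v. comm x u * commutator ((v * y) # as)))"
proof -
  let ?X = "\<lambda>ps::('h \<times> 'h) list. prod_list (map fst ps)"
  let ?Y = "\<lambda>ps::('h \<times> 'h) list. prod_list (map (\<lambda>p. S (snd p)) ps)"
  have one: "commutator (c # as) =
      (\<Sum>ps\<leftarrow>product_lists (map \<Delta> as). sw c (\<lambda>p q. p * ?X ps * S q * ?Y ps))" for c
    unfolding commutator_def sum_list_product_lists_Cons by (simp add: mult.assoc)
  have "commutator (a # b # as) = (\<Sum>ps\<leftarrow>product_lists (map \<Delta> as).
      sw a (\<lambda>x y. sw b (\<lambda>u v. x * u * ?X ps * S y * S v * ?Y ps)))"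
    unfolding commutator_def sum_list_product_lists_Cons by (simp add: mult.assoc sw_swap[of a])
  also have "\<dots> = sw a (\<lambda>x y. sw b (\<lambda>u v. \<Sum>ps\<leftarrow>product_lists (map \<Delta> as).
      comm x u * sw (v * y) (\<lambda>p q. p * ?X ps * S q * ?Y ps)))"
    by (simp only: comm_split sw_sum_list)
  also have "\<dots> = sw a (\<lambda>x y. sw b (\<lambda>u v. comm x u * commutator ((v * y) # as)))"
    by (simp add: one sum_list_const_mult)
  finally show ?thesis .
qed

end

section \<open>Slices and integrals\<close>

context hopf_algebra
begin

text \<open>
  \<open>\<Sum> f(x\<^sub>1)x\<^sub>2\<close>. A subspace is a left coideal iff it is closed under slices along all linear forms,
  which avoids tensors with a leg in a subspace.
\<close>

definition slice :: "('h \<Rightarrow> 'k) \<Rightarrow> 'h \<Rightarrow> 'h"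
  where "slice f x = sw x (\<lambda>u v. scale (f u) v)"

lemma lin_slice [lin_intros]: "form f \<Longrightarrow> lin g \<Longrightarrow> lin (\<lambda>x. slice f (g x))"
  unfolding slice_def by (intro lin_intros; assumption)+

lemma sw_diff: "sw a F - sw a G = sw a (\<lambda>x y. F x y - G x y)"
  unfolding sw_def case_prod_unfold by (simp add: sum_list_subtractf)

lemma subspace_left_coideal: "left_coideal N \<Longrightarrow> subspace N"
  by (simp add: left_coideal_def)

lemma slice_in_left_coideal:
  assumes N: "left_coideal N" and x: "x \<in> N" and f: "form f"
  shows "slice f x \<in> N"
proof -
  from N x obtain t where t: "snd ` set t \<subseteq> N"
      "tensor_eq scale [[x, y]. (x, y) \<leftarrow> \<Delta> x] [[x, y]. (x, y) \<leftarrow> t]"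
    unfolding left_coideal_def by blast
  have "slice f x = (\<Sum>(x, y)\<leftarrow>t. scale (f x) y)"
    unfolding slice_def sw_def by (rule sw_cong_tensor_eq[OF t(2)]) (intro lin_intros f)+
  moreover have "(\<Sum>(x, y)\<leftarrow>t. scale (f x) y) \<in> N"
    using t(1)
    by (induction t) (auto intro!: subspace_0 subspace_add subspace_scale subspace_left_coideal[OF N])
  ultimately show ?thesis by simp
qed

text \<open>
  \<open>\<Delta>{a,b} = \<Sum> a\<^sub>1b\<^sub>1S(a\<^sub>3)S(b\<^sub>3) \<otimes> {a\<^sub>2,b\<^sub>2}\<close>, because \<open>S\<close> reverses the legs and so leaves the inner ones
  on the right. Hence the commutators span a left coideal.
\<close>

lemma slice_comm:
  assumes f: "form f"
  shows "slice f (comm a b) = sw a (\<lambda>x z. sw z (\<lambda>m y. sw b (\<lambda>u w. sw w (\<lambda>n v.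
    scale (f (x * u * S y * S v)) (comm m n)))))"
proof -
  define Q where "Q x x' y y' u u' v v' = scale (f (x * u * S y' * S v')) (x' * u' * S y * S v)"
    for x x' y y' u u' v v'
  note fl = lin_intros form_comp[OF f]
  have "slice f (x * u * S y * S v) =
      sw x (\<lambda>x x'. sw u (\<lambda>u u'. sw y (\<lambda>y y'. sw v (\<lambda>v v'. Q x x' y y' u u' v v'))))" for x u y v
    unfolding slice_def Q_def
    by (subst sw_mult, (intro fl)+)+ (subst sw_S, (intro fl)+, simp?)+
  then have slice: "slice f (x * u * S y * S v) =
      sw x (\<lambda>x x'. sw y (\<lambda>y y'. sw u (\<lambda>u u'. sw v (\<lambda>v v'. Q x x' y y' u u' v v'))))" for x u y v
    by (simp only: sw_swap[of u y])
  have b: "sw b (\<lambda>u v. sw u (\<lambda>u u'. sw v (\<lambda>v v'. Q x x' y y' u u' v v'))) =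
      sw b (\<lambda>u w. sw w (\<lambda>n v'. sw n (\<lambda>u' v. Q x x' y y' u u' v v')))" for x x' y y'
    unfolding Q_def by (rule sw_middle) (intro fl)+
  have m: "sw m (\<lambda>x' y. sw b (\<lambda>u w. sw w (\<lambda>n v'. sw n (\<lambda>u' v. Q x x' y y' u u' v v')))) =
      sw b (\<lambda>u w. sw w (\<lambda>n v. scale (f (x * u * S y' * S v)) (comm m n)))" for m x y'
    unfolding Q_def comm_swap
    by (subst lin_sw[of "scale _"], intro lin_intros)+ (simp add: sw_swap[of m])
  have "slice f (comm a b) = sw a (\<lambda>x y. sw b (\<lambda>u v. slice f (x * u * S y * S v)))"
    unfolding comm_def by (subst lin_sw[of "slice f"], intro fl f)+ simp
  also have "\<dots> = sw a (\<lambda>x y. sw x (\<lambda>x x'. sw y (\<lambda>y y'.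
      sw b (\<lambda>u v. sw u (\<lambda>u u'. sw v (\<lambda>v v'. Q x x' y y' u u' v v'))))))"
    unfolding slice by (simp only: sw_swap[of b])
  also have "\<dots> = sw a (\<lambda>x z. sw z (\<lambda>m y'. sw m (\<lambda>x' y.
      sw b (\<lambda>u w. sw w (\<lambda>n v'. sw n (\<lambda>u' v. Q x x' y y' u u' v v'))))))"
    unfolding b unfolding Q_def by (rule sw_middle) (intro fl)+
  finally show ?thesis by (simp only: m)
qed

text \<open>
  For a left integral, \<open>\<Sum> \<Lambda>\<^sub>1 \<otimes> h\<Lambda>\<^sub>2 = \<Sum> S(h)\<Lambda>\<^sub>1 \<otimes> \<Lambda>\<^sub>2\<close>: insert \<open>\<Sum> S(h\<^sub>1)h\<^sub>2\<close> in front of \<open>\<Lambda>\<^sub>1\<close>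
  and absorb \<open>\<Delta>(h\<^sub>2\<Lambda>) = \<epsilon>(h\<^sub>2)\<Delta>(\<Lambda>)\<close>.
\<close>

lemma integral_slice_shift:
  assumes integral: "\<And>h. h * \<Lambda> = scale (\<epsilon> h) \<Lambda>" and f: "form f"
  shows "h * slice f \<Lambda> = slice (\<lambda>x. f (S h * x)) \<Lambda>"
proof -
  define F where "F x y z = sw \<Lambda> (\<lambda>u v. scale (f (S x * y * u)) (z * v))" for x y z
  have F: "lin (\<lambda>x. F x y z)" "lin (\<lambda>y. F x y z)" "lin (\<lambda>z. F x y z)" for x y z
    unfolding F_def by (intro lin_intros form_comp[OF f])+
  have G: "lin (\<lambda>t. sw \<Lambda> (\<lambda>u v. scale (f (t * u)) (z * v)))" for z
    by (intro lin_intros form_comp[OF f])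
  have "sw h (\<lambda>s z. sw s (\<lambda>x y. F x y z)) = sw \<Lambda> (\<lambda>u v. scale (f u) (h * v))"
    unfolding F_def
    by (rule sw_cancel_first, intro lin_intros, subst sw_antipode_left_lin[OF G]) simp
  moreover have "sw h (\<lambda>s z. sw s (\<lambda>x y. F x y z)) = slice (\<lambda>x. f (S h * x)) \<Lambda>"
  proof (rule sw_cancel_last)
    show "lin (\<lambda>h. slice (\<lambda>x. f (S h * x)) \<Lambda>)"
      unfolding slice_def by (intro lin_intros form_comp[OF f])
    fix m x
    have "sw m (\<lambda>y z. F x y z) = sw (m * \<Lambda>) (\<lambda>u v. scale (f (S x * u)) v)"
      unfolding F_def by (subst sw_mult) (auto simp: mult.assoc intro!: lin_intros form_comp[OF f])
    also have "\<dots> = scale (\<epsilon> m) (slice (\<lambda>x'. f (S x * x')) \<Lambda>)"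
      unfolding integral slice_def
      by (rule sw_scale) (intro lin_intros form_comp[OF f])+
    finally show "sw m (\<lambda>y z. F x y z) = scale (\<epsilon> m) (slice (\<lambda>x'. f (S x * x')) \<Lambda>)" .
  qed (intro F)+
  moreover have "h * slice f \<Lambda> = sw \<Lambda> (\<lambda>u v. scale (f u) (h * v))"
    unfolding slice_def
    by (subst lin_sw[of "\<lambda>t. h * t"], intro lin_intros) (simp add: scale_mult_right)
  ultimately show ?thesis by simp
qed

text \<open>
  A left ideal complement \<open>J\<close> of \<open>ker \<epsilon>\<close> consists of left integrals: for \<open>y \<in> J\<close> the element
  \<open>hy - \<epsilon>(h)y\<close> lies in \<open>J\<close> and in the kernel.
\<close>

lemma semisimple_imp_integral:
  assumes "semisimple"
  obtains \<Lambda> where "\<And>h. h * \<Lambda> = scale (\<epsilon> h) \<Lambda>" "\<epsilon> \<Lambda> = 1"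
proof -
  let ?I = "{x. \<epsilon> x = 0}"
  have "left_ideal ?I"
    unfolding left_ideal_def subspace_def using form_scale[OF form_eps_raw, of 0 0]
    by (auto simp: form_add[OF form_eps_raw] form_scale[OF form_eps_raw] \<epsilon>_mult)
  from assms[unfolded semisimple_def, rule_format, OF this]
  obtain J where J: "left_ideal J" "?I \<inter> J = {0}" "{x + y | x y. x \<in> ?I \<and> y \<in> J} = UNIV"
    by auto
  have "1 \<in> {x + y | x y. x \<in> ?I \<and> y \<in> J}"
    unfolding J(3) ..
  then obtain x y where xy: "1 = x + y" "\<epsilon> x = 0" "y \<in> J"
    by auto
  have y: "\<epsilon> y = 1"
    using form_add[OF form_eps_raw, of x y] xy(1,2) \<epsilon>_one by simp
  have "h * y = scale (\<epsilon> h) y" for h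
  proof -
    have "h * y - scale (\<epsilon> h) y \<in> J"
      using J(1) xy(3) unfolding left_ideal_def by (auto intro: subspace_diff subspace_scale)
    moreover have "\<epsilon> (h * y - scale (\<epsilon> h) y) = 0"
      using form_add[OF form_eps_raw, of "h * y - scale (\<epsilon> h) y" "scale (\<epsilon> h) y"]
      by (simp add: form_scale[OF form_eps_raw] \<epsilon>_mult y)
    ultimately have "h * y - scale (\<epsilon> h) y \<in> {x. \<epsilon> x = 0} \<inter> J" by simp
    then show ?thesis unfolding J(2) by simp
  qed
  with y that show thesis by blast
qed

section \<open>Generated subalgebras\<close>

lemma subalgebra_algebra_generated: "subalgebra (algebra_generated X)"
  unfolding algebra_generated_def
  by (rule hull_in) (auto simp: subalgebra_def intro: subspace_Inter)

lemma algebra_generated_superset: "X \<subseteq> algebra_generated X"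
  unfolding algebra_generated_def by (rule hull_subset)

lemma algebra_generated_minimal: "X \<subseteq> N \<Longrightarrow> subalgebra N \<Longrightarrow> algebra_generated X \<subseteq> N"
  unfolding algebra_generated_def by (rule hull_minimal)

lemma algebra_generated_span: "algebra_generated (span X) = algebra_generated X"
proof
  show "algebra_generated (span X) \<subseteq> algebra_generated X"
    using algebra_generated_superset subalgebra_algebra_generated
    by (intro algebra_generated_minimal span_minimal) (auto simp: subalgebra_def)
  show "algebra_generated X \<subseteq> algebra_generated (span X)"
    using algebra_generated_superset[of "span X"] span_superset[of X]
    by (intro algebra_generated_minimal subalgebra_algebra_generated) blast
qed

section \<open>The adjoint action and quotients\<close>

lemma ad_mult: "ad h (x * y) = sw h (\<lambda>p q. ad p x * ad q y)"
proof -
  have "ad p x * ad q y = sw p (\<lambda>u v. sw q (\<lambda>s t. u * x * (S v * s) * y * S t))" for p q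
    unfolding ad_def
    by (subst lin_sw[of "\<lambda>t. t * _"], intro lin_intros, subst lin_sw[of "\<lambda>t. _ * t"], intro lin_intros)
      (simp add: mult.assoc)
  then have "sw h (\<lambda>p q. ad p x * ad q y) =
      sw h (\<lambda>p q. sw p (\<lambda>u v. sw q (\<lambda>s t. u * x * (S v * s) * y * S t)))"
    by simp
  also have "\<dots> = sw h (\<lambda>u t. u * (x * y) * S t)"
  proof (rule sw_cancel_middle)
    fix m u t
    have "lin (\<lambda>r. u * x * r * y * S t)"
      by (intro lin_intros)
    from sw_antipode_left_lin[OF this]
    show "sw m (\<lambda>v s. u * x * (S v * s) * y * S t) = scale (\<epsilon> m) (u * (x * y) * S t)"
      by (simp add: mult.assoc)
  qed (intro lin_intros)+
  finally show ?thesis by (simp add: ad_def)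
qed

lemma ad_one: "ad h 1 = scale (\<epsilon> h) 1"
  by (simp add: ad_def sw_antipode_right)

lemma eps_ad: "\<epsilon> (ad h x) = \<epsilon> h * \<epsilon> x"
proof -
  have lin: "lin (\<lambda>x. scale (\<epsilon> x) 1)"
    by (intro lin_intros)
  have "scale (\<epsilon> (ad h x)) 1 = sw h (\<lambda>u v. scale (\<epsilon> v) (scale (\<epsilon> u * \<epsilon> x) 1))"
    unfolding ad_def by (subst lin_sw[OF lin]) (simp add: \<epsilon>_mult eps_S ac_simps)
  also have "\<dots> = scale (\<epsilon> h * \<epsilon> x) 1"
    by (rule sw_counit_right) (intro lin_intros)
  finally show ?thesis by simp
qed

text \<open>
  \<open>mg\<^sup>-\<^sup>1 = g\<^sup>-\<^sup>1(gmg\<^sup>-\<^sup>1)\<close>. It moves \<open>m\<close> to the right at the cost of the adjoint action, but only past elements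
  in the image of \<open>S\<close>.
\<close>

lemma mult_S_eq: "m * S g = sw g (\<lambda>u v. S u * ad v m)"
proof -
  have "sw g (\<lambda>u v. S u * ad v m) = sw g (\<lambda>u v. sw v (\<lambda>s t. S u * s * m * S t))"
    unfolding ad_def by (subst lin_sw[of "\<lambda>t. _ * t"], intro lin_intros) (simp add: mult.assoc)
  also have "\<dots> = sw g (\<lambda>v t. sw v (\<lambda>u s. S u * s * m * S t))"
    by (rule sw_coassoc[symmetric]) (intro lin_intros)+
  also have "\<dots> = m * S g"
  proof (rule sw_cancel_first)
    fix n t
    have "lin (\<lambda>r. r * m * S t)"
      by (intro lin_intros)
    from sw_antipode_left_lin[OF this]
    show "sw n (\<lambda>u s. S u * s * m * S t) = scale (\<epsilon> n) (m * S t)" by simp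
  qed (intro lin_intros)
  finally show ?thesis ..
qed

lemma normal_iff_ad: "normal N \<longleftrightarrow> (\<forall>h. \<forall>n\<in>N. ad h n \<in> N)"
  by (simp add: normal_def ad_def sw_def)

lemma subspace_ideal_of: "subspace (ideal_of N)"
  by (simp add: ideal_of_def)

lemma ideal_of_mult_left: "x \<in> ideal_of N \<Longrightarrow> h * x \<in> ideal_of N"
  unfolding ideal_of_def
proof (induction rule: span_induct_alt)
  case base
  then show ?case by (simp add: span_zero)
next
  case (step c x y)
  then obtain h' m where x: "x = h' * m" "m \<in> augmentation N" by blast
  have "h * (scale c x + y) = scale c ((h * h') * m) + h * y"
    by (simp add: x distrib_left scale_mult_right mult.assoc)
  moreover have "(h * h') * m \<in> {h * x |h x. x \<in> augmentation N}"
    using x by blast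
  ultimately show ?case
    using step.IH by (metis (no_types, lifting) span_add span_scale span_base)
qed

lemma commutative_quotient_mult_right:
  assumes "commutative_quotient N" "x \<in> ideal_of N"
  shows "x * h \<in> ideal_of N"
proof -
  have "x * h = h * x + (x * h - h * x)" by simp
  also have "\<dots> \<in> ideal_of N"
    using assms ideal_of_mult_left subspace_ideal_of
    by (intro subspace_add) (auto simp: commutative_quotient_def)
  finally show ?thesis .
qed

lemma augmentation_mult_right:
  assumes "surj S" "subspace N" "normal N" "m \<in> augmentation N"
  shows "m * h \<in> ideal_of N"
proof -
  obtain g where h: "h = S g" using assms(1) by (metis surjD)
  have "ad v m \<in> augmentation N" for v
    using assms(3,4) by (auto simp: normal_iff_ad augmentation_def eps_ad)
  then have "sw g (\<lambda>u v. S u * ad v m) \<in> ideal_of N"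
    by (intro sw_in_subspace subspace_ideal_of) (auto simp: ideal_of_def intro: span_base)
  then show ?thesis by (simp add: h mult_S_eq)
qed

section \<open>The algebra generated by commutators\<close>

definition comm_algebra :: "'h set"
  where "comm_algebra = algebra_generated {comm a b | a b. True}"

lemma subalgebra_comm_algebra: "subalgebra comm_algebra"
  unfolding comm_algebra_def by (rule subalgebra_algebra_generated)

lemma comm_algebra_minimal: "(\<And>a b. comm a b \<in> N) \<Longrightarrow> subalgebra N \<Longrightarrow> comm_algebra \<subseteq> N"
  unfolding comm_algebra_def by (rule algebra_generated_minimal) auto

lemma comm_in_comm_algebra: "comm a b \<in> comm_algebra"
  unfolding comm_algebra_def using algebra_generated_superset[of "{comm a b | a b. True}"] by blast

lemma subspace_comm_algebra: "subspace comm_algebra"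
  using subalgebra_comm_algebra by (simp add: subalgebra_def)

lemma normal_comm_algebra: "normal comm_algebra"
proof -
  let ?A = "comm_algebra"
  let ?N = "{x. x \<in> ?A \<and> (\<forall>h. ad h x \<in> ?A)}"
  have A: "x * y \<in> ?A" if "x \<in> ?A" "y \<in> ?A" for x y
    using that subalgebra_comm_algebra by (auto simp: subalgebra_def)
  have one: "1 \<in> ?A"
    using subalgebra_comm_algebra by (auto simp: subalgebra_def)
  have "subalgebra ?N"
    unfolding subalgebra_def
  proof (intro conjI ballI)
    show "subspace ?N"
      using subspace_comm_algebra
      by (auto simp: subspace_def lin_add[OF lin_ad[OF lin_id]] lin_scale[OF lin_ad[OF lin_id]]
          lin_zero[OF lin_ad[OF lin_id]])
    show "1 \<in> ?N"
      using one subspace_comm_algebra by (auto simp: ad_one intro: subspace_scale)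
    show "x * y \<in> ?N" if "x \<in> ?N" "y \<in> ?N" for x y
      using that by (auto simp: ad_mult intro!: A sw_in_subspace subspace_comm_algebra)
  qed
  moreover have "comm a b \<in> ?N" for a b
    by (auto simp: comm_in_comm_algebra ad_comm
        intro!: A sw_in_subspace subspace_comm_algebra)
  ultimately have "?A \<subseteq> ?N"
    by (intro comm_algebra_minimal)
  then show ?thesis by (auto simp: normal_iff_ad)
qed

lemma commutative_quotient_comm_algebra:
  assumes "surj S" shows "commutative_quotient comm_algebra"
  unfolding commutative_quotient_def
proof (intro allI)
  fix a b
  have "b * a = sw a (\<lambda>x y. scale (\<epsilon> x) (sw b (\<lambda>u v. scale (\<epsilon> u) (v * y))))"
    by (subst sw_counit_left, intro lin_intros)+ simp
  also have "\<dots> = sw a (\<lambda>x y. sw b (\<lambda>u v. scale (\<epsilon> x * \<epsilon> u) 1 * (v * y)))"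
    by (subst lin_sw, intro lin_intros) (simp add: scale_mult_left)
  finally have "a * b - b * a =
      sw a (\<lambda>x y. sw b (\<lambda>u v. (comm x u - scale (\<epsilon> x * \<epsilon> u) 1) * (v * y)))"
    by (subst comm_reorder) (simp add: sw_diff left_diff_distrib)
  moreover have "comm x u - scale (\<epsilon> x * \<epsilon> u) 1 \<in> augmentation comm_algebra" for x u
  proof -
    have "\<epsilon> (comm x u - scale (\<epsilon> x * \<epsilon> u) 1) = 0"
      using form_add[OF form_eps_raw, of "comm x u - scale (\<epsilon> x * \<epsilon> u) 1" "scale (\<epsilon> x * \<epsilon> u) 1"]
      by (simp add: comm_eps form_scale[OF form_eps_raw] \<epsilon>_one)
    moreover have "1 \<in> comm_algebra"
      using subalgebra_comm_algebra by (auto simp: subalgebra_def)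
    ultimately show ?thesis
      using subspace_comm_algebra
      by (auto simp: augmentation_def intro!: subspace_diff subspace_scale comm_in_comm_algebra)
  qed
  ultimately show "a * b - b * a \<in> ideal_of comm_algebra"
    by (auto intro!: sw_in_subspace subspace_ideal_of
        augmentation_mult_right[OF assms subspace_comm_algebra normal_comm_algebra])
qed

text \<open>
  Modulo \<open>HN\<^sup>+\<close> the factors \<open>b\<^sub>1\<close> and \<open>S(a\<^sub>2)\<close> commute, and then \<open>\<Sum> a\<^sub>1S(a\<^sub>2)b\<^sub>1S(b\<^sub>2)\<close> is a scalar.
\<close>

lemma comm_trivial_in_quotient:
  assumes "commutative_quotient N"
  shows "comm a b - scale (\<epsilon> (comm a b)) 1 \<in> ideal_of N"
proof -
  have "sw a (\<lambda>x y. sw b (\<lambda>u v. x * (S y * u) * S v)) =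
      sw a (\<lambda>x y. scale (\<epsilon> b) (x * S y))"
  proof -
    have "sw b (\<lambda>u v. x * (S y * u) * S v) = scale (\<epsilon> b) (x * S y)" for x y
    proof -
      have "lin (\<lambda>t. x * S y * t)"
        by (intro lin_intros)
      from sw_antipode_right_lin[OF this] show ?thesis by (simp add: mult.assoc)
    qed
    then show ?thesis by simp
  qed
  also have "\<dots> = scale (\<epsilon> (comm a b)) 1"
    by (subst sw_antipode_right_lin, intro lin_intros) (simp add: comm_eps)
  finally have "comm a b - scale (\<epsilon> (comm a b)) 1 =
      sw a (\<lambda>x y. sw b (\<lambda>u v. x * u * S y * S v)) -
      sw a (\<lambda>x y. sw b (\<lambda>u v. x * (S y * u) * S v))"
    by (simp only: comm_def)
  also have "\<dots> = sw a (\<lambda>x y. sw b (\<lambda>u v. x * (u * S y - S y * u) * S v))"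
    by (simp add: sw_diff mult.assoc left_diff_distrib right_diff_distrib)
  also have "\<dots> \<in> ideal_of N"
    using assms
    by (intro sw_in_subspace subspace_ideal_of commutative_quotient_mult_right[OF assms]
        ideal_of_mult_left) (auto simp: commutative_quotient_def)
  finally show ?thesis .
qed

lemma commutator_in_span_products:
  assumes "length as \<ge> 2"
  shows "commutator as \<in> span {prod_list cs | cs. cs \<noteq> [] \<and> set cs \<subseteq> {comm a b | a b. True}}"
  using assms
proof (induction "length as" arbitrary: as rule: less_induct)
  case less
  let ?P = "{prod_list cs | cs. cs \<noteq> [] \<and> set cs \<subseteq> {comm a b | a b. True}}"
  have comm: "comm a b * x \<in> span ?P" if "x \<in> span ?P" for a b x
    using that
  proof (induction rule: span_induct_alt)
    case base
    then show ?case by (simp add: span_zero)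
  next
    case (step c x y)
    then obtain cs where cs: "x = prod_list cs" "cs \<noteq> []" "set cs \<subseteq> {comm a b | a b. True}" by blast
    have "comm a b * x \<in> ?P"
      using cs by (intro CollectI exI[of _ "comm a b # cs"]) auto
    then have "scale c (comm a b * x) + comm a b * y \<in> span ?P"
      using step.IH by (intro span_add span_scale) (auto intro: span_base)
    then show ?case by (simp add: distrib_left scale_mult_right)
  qed
  from less.prems obtain a b cs where as: "as = a # b # cs"
    by (metis Suc_le_length_iff numeral_2_eq_2)
  show ?case
  proof (cases "cs = []")
    case True
    have "comm a b \<in> ?P"
      by (intro CollectI exI[of _ "[comm a b]"]) auto
    then show ?thesis by (simp add: as True commutator_two_comm span_base)
  next
    case False
    have "commutator (c # cs) \<in> span ?P" for c
      using less.hyps[of "c # cs"] False by (cases cs) (auto simp: as)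
    then show ?thesis
      unfolding as commutator_Cons_Cons by (intro sw_in_subspace subspace_span comm)
  qed
qed

lemma commutator_append_ones: "commutator (a # b # replicate k 1) = comm a b"
proof (induction k arbitrary: a b)
  case 0
  then show ?case by (simp add: commutator_two_comm)
next
  case (Suc k)
  have *: "commutator (c # replicate (Suc k) 1) = scale (\<epsilon> c) 1" for c
  proof -
    have "comm c 1 = sw c (\<lambda>x y. x * S y)"
      unfolding comm_swap by (subst sw_one, (intro lin_intros)+) (simp add: S_one)
    with Suc.IH[of c 1] show ?thesis by (simp add: sw_antipode_right)
  qed
  have "commutator (a # b # replicate (Suc k) 1) =
      sw a (\<lambda>x y. sw b (\<lambda>u v. scale (\<epsilon> y) (scale (\<epsilon> v) (comm x u))))"
    unfolding commutator_Cons_Cons * by (simp add: \<epsilon>_mult scale_mult_right mult.commute)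
  also have "\<dots> = sw a (\<lambda>x y. scale (\<epsilon> y) (comm x b))"
    by (subst lin_sw[symmetric], intro lin_intros)
      (subst sw_counit_right, auto intro!: lin_intros)
  also have "\<dots> = comm a b"
    by (rule sw_counit_right) (intro lin_intros)
  finally show ?case .
qed

lemma algebra_generated_Com:
  assumes "n > 1" shows "algebra_generated (Com n) = comm_algebra"
  unfolding Com_def algebra_generated_span
proof
  let ?C = "{commutator as | as. length as = n}"
  have "prod_list cs \<in> comm_algebra" if "set cs \<subseteq> {comm a b | a b. True}" for cs
    using that subalgebra_comm_algebra
    by (induction cs) (auto simp: subalgebra_def comm_in_comm_algebra)
  then have "span {prod_list cs | cs. cs \<noteq> [] \<and> set cs \<subseteq> {comm a b | a b. True}} \<subseteq> comm_algebra"
    by (intro span_minimal subspace_comm_algebra) auto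
  then show "algebra_generated ?C \<subseteq> comm_algebra"
    using assms commutator_in_span_products
    by (intro algebra_generated_minimal subalgebra_comm_algebra) fastforce
  have "comm a b \<in> ?C" for a b
    using assms commutator_append_ones[of a b "n - 2"]
    by (intro CollectI exI[of _ "a # b # replicate (n - 2) 1"]) auto
  then show "comm_algebra \<subseteq> algebra_generated ?C"
    using algebra_generated_superset[of ?C]
    by (intro comm_algebra_minimal subalgebra_algebra_generated) auto
qed

end

section \<open>Left coideals in coordinates\<close>

lemma (in vector_space) single_linear_combination:
  fixes u v :: "'b list"
  assumes "finite A"
  shows "Poly_Mapping.single (u @ (\<Sum>b\<in>A. scale (g b) b) # v) 1 -
      (\<Sum>b\<in>A. free_scale (g b) (Poly_Mapping.single (u @ b # v) 1))
    \<in> free.span (multilinear_relations scale)" (is "_ \<in> free.span ?R")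
  using assms
proof (induction A rule: finite_induct)
  case empty
  have "Poly_Mapping.single (u @ scale 0 0 # v) 1 -
      free_scale 0 (Poly_Mapping.single (u @ 0 # v) 1) \<in> free.span ?R"
    by (rule free.span_base) (unfold multilinear_relations_def, blast)
  then show ?case by simp
next
  case (insert b A)
  let ?s = "\<lambda>x. Poly_Mapping.single (u @ x # v) (1::'a)"
  let ?x = "scale (g b) b" and ?y = "\<Sum>b\<in>A. scale (g b) b"
  have 1: "?s (?x + ?y) - ?s ?x - ?s ?y \<in> free.span ?R"
    by (rule free.span_base) (unfold multilinear_relations_def, blast)
  have 2: "?s ?x - free_scale (g b) (?s b) \<in> free.span ?R"
    by (rule free.span_base) (unfold multilinear_relations_def, blast)
  have "(?s (?x + ?y) - ?s ?x - ?s ?y) + (?s ?x - free_scale (g b) (?s b)) +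
      (?s ?y - (\<Sum>b\<in>A. free_scale (g b) (?s b))) \<in> free.span ?R"
    by (intro free.span_add 1 2 insert.IH)
  then show ?case using insert.hyps by (simp add: algebra_simps)
qed

locale finite_hopf_algebra =
  hopf_algebra scale \<Delta> \<epsilon> S + finite_dimensional_vector_space scale Basis
  for scale :: "'k::field \<Rightarrow> 'h::ring_1 \<Rightarrow> 'h"
    and \<Delta> :: "'h \<Rightarrow> ('h \<times> 'h) list" and \<epsilon> :: "'h \<Rightarrow> 'k" and S :: "'h \<Rightarrow> 'h"
    and Basis :: "'h set"

context finite_hopf_algebra
begin

definition coord :: "'h \<Rightarrow> 'h \<Rightarrow> 'k"
  where "coord b x = representation Basis x b"

lemma form_coord: "form (coord b)"
  using independent_Basis span_Basis
  by (auto simp: form_def coord_def representation_add representation_scale)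

lemma sum_coord: "(\<Sum>b\<in>Basis. scale (coord b x) b) = x"
  unfolding coord_def using independent_Basis span_Basis finite_Basis
  by (intro sum_representation_eq) auto

text \<open>
  \<open>\<Delta> x = \<Sum>\<^sub>b b \<otimes> x\<^sub>b\<close> with the slices \<open>x\<^sub>b\<close> along the dual basis. If \<open>x\<close> lies in a left coideal, then
  this is a representative of \<open>\<Delta> x\<close> whose right legs lie there.
\<close>

lemma sw_eq_sum_slices:
  assumes "\<And>y. lin (\<lambda>x. F x y)" "\<And>x. lin (F x)"
  shows "sw x F = (\<Sum>b\<in>Basis. F b (slice (coord b) x))"
proof -
  have "F u v = (\<Sum>b\<in>Basis. F b (scale (coord b u) v))" for u v
  proof -
    have "F u v = F (\<Sum>b\<in>Basis. scale (coord b u) b) v"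
      by (simp add: sum_coord)
    then show ?thesis
      by (simp only: lin_sum[OF assms(1)] lin_scale[OF assms(1)] lin_scale[OF assms(2)])
  qed
  then have "sw x F = sw x (\<lambda>u v. \<Sum>b\<in>Basis. F b (scale (coord b u) v))"
    by metis
  also have "\<dots> = (\<Sum>b\<in>Basis. sw x (\<lambda>u v. F b (scale (coord b u) v)))"
    by (rule sw_sum[symmetric])
  finally show ?thesis
    unfolding slice_def by (simp add: lin_sw[OF assms(2)])
qed

text \<open>
  Conversely to the universal property, tensors are separated by bilinear maps: modulo the relations
  each pure tensor is the sum of its coordinates times tensors of basis elements.
\<close>

lemma tensor_eqI:
  assumes "\<And>F. (\<And>y. lin (\<lambda>x. F x y)) \<Longrightarrow> (\<And>x. lin (F x)) \<Longrightarrow>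
      (\<Sum>(x, y)\<leftarrow>s. F x y) = (\<Sum>(x, y)\<leftarrow>t. F x y)"
  shows "tensor_eq scale [[x, y]. (x, y) \<leftarrow> s] [[x, y]. (x, y) \<leftarrow> t]"
proof -
  let ?R = "free.span (multilinear_relations scale)"
  let ?s = "\<lambda>x y. Poly_Mapping.single [x, y] (1::'k)"
  define q where "q x y = (\<Sum>b\<in>Basis. \<Sum>c\<in>Basis. free_scale (coord b x * coord c y) (?s b c))" for x y
  have single: "?s x y - q x y \<in> ?R" for x y
  proof -
    have 1: "?s x y - (\<Sum>b\<in>Basis. free_scale (coord b x) (?s b y)) \<in> ?R"
      using single_linear_combination[OF finite_Basis, of "[]" "\<lambda>b. coord b x" "[y]"]
      by (simp add: sum_coord)
    have 2: "?s b y - (\<Sum>c\<in>Basis. free_scale (coord c y) (?s b c)) \<in> ?R" for b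
      using single_linear_combination[OF finite_Basis, of "[b]" "\<lambda>b. coord b y" "[]"]
      by (simp add: sum_coord)
    have "(\<Sum>b\<in>Basis. free_scale (coord b x)
        (?s b y - (\<Sum>c\<in>Basis. free_scale (coord c y) (?s b c)))) \<in> ?R"
      by (intro free.span_sum free.span_scale 2)
    from free.span_add[OF 1 this] show ?thesis
      by (simp add: q_def free.scale_right_diff_distrib free.scale_sum_right sum_subtractf)
  qed
  have list: "(\<Sum>(x, y)\<leftarrow>l. ?s x y) - (\<Sum>(x, y)\<leftarrow>l. q x y) \<in> ?R" for l
  proof (induction l)
    case Nil
    then show ?case by (simp add: free.span_zero)
  next
    case (Cons p l)
    from free.span_add[OF single[of "fst p" "snd p"] Cons] show ?case
      by (simp add: case_prod_unfold algebra_simps)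
  qed
  have coeff: "(\<Sum>(x, y)\<leftarrow>l. q x y) =
      (\<Sum>b\<in>Basis. \<Sum>c\<in>Basis. free_scale (\<Sum>(x, y)\<leftarrow>l. coord b x * coord c y) (?s b c))" for l
    by (induction l) (auto simp: q_def sum.distrib free.scale_left_distrib)
  have "(\<Sum>(x, y)\<leftarrow>s. coord b x * coord c y) = (\<Sum>(x, y)\<leftarrow>t. coord b x * coord c y)" for b c
  proof -
    have "scale (\<Sum>(x, y)\<leftarrow>l. coord b x * coord c y) 1 =
        (\<Sum>(x, y)\<leftarrow>l. scale (coord b x * coord c y) 1)" for l
      by (induction l) (auto simp: scale_left_distrib)
    moreover have "(\<Sum>(x, y)\<leftarrow>s. scale (coord b x * coord c y) 1) =
        (\<Sum>(x, y)\<leftarrow>t. scale (coord b x * coord c y) 1)"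
      by (rule assms) (intro lin_intros form_coord)+
    ultimately have "scale (\<Sum>(x, y)\<leftarrow>s. coord b x * coord c y) 1 =
        scale (\<Sum>(x, y)\<leftarrow>t. coord b x * coord c y) 1"
      by (simp only:)
    then show ?thesis by (simp only: scale_cancel_right) simp
  qed
  then have "(\<Sum>(x, y)\<leftarrow>s. q x y) = (\<Sum>(x, y)\<leftarrow>t. q x y)"
    by (simp add: coeff)
  with free.span_diff[OF list[of s] list[of t]] show ?thesis
    unfolding tensor_eq_def by (simp add: o_def case_prod_unfold)
qed

lemma left_coidealI:
  assumes N: "subspace N" and slice: "\<And>x f. x \<in> N \<Longrightarrow> form f \<Longrightarrow> slice f x \<in> N"
  shows "left_coideal N"
  unfolding left_coideal_def
proof (intro conjI ballI N)
  fix x assume x: "x \<in> N"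
  obtain bs where bs: "set bs = Basis" "distinct bs"
    using finite_Basis finite_distinct_list by blast
  define t where "t = map (\<lambda>b. (b, slice (coord b) x)) bs"
  have "tensor_eq scale [[x, y]. (x, y) \<leftarrow> \<Delta> x] [[x, y]. (x, y) \<leftarrow> t]"
  proof (rule tensor_eqI)
    fix F :: "'h \<Rightarrow> 'h \<Rightarrow> 'h"
    assume F: "\<And>y. lin (\<lambda>x. F x y)" "\<And>x. lin (F x)"
    show "(\<Sum>(x, y)\<leftarrow>\<Delta> x. F x y) = (\<Sum>(x, y)\<leftarrow>t. F x y)"
      using sw_eq_sum_slices[OF F, of x] bs
      by (simp add: sw_def t_def o_def sum_list_distinct_conv_sum_set)
  qed
  moreover have "snd ` set t \<subseteq> N"
    using x by (auto simp: t_def intro!: slice form_coord)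
  ultimately show "\<exists>t. snd ` set t \<subseteq> N \<and>
      tensor_eq scale [[x, y]. (x, y) \<leftarrow> \<Delta> x] [[x, y]. (x, y) \<leftarrow> t]" by blast
qed

lemma slice_mult:
  assumes f: "form f"
  shows "slice f (x * y) = (\<Sum>b\<in>Basis. slice (coord b) x * slice (\<lambda>p. f (b * p)) y)"
proof -
  note fl = lin_intros form_comp[OF f]
  have "slice f (x * y) = sw x (\<lambda>u v. sw y (\<lambda>p q. scale (f (u * p)) (v * q)))"
    unfolding slice_def by (subst sw_mult) (auto intro!: lin_intros f)
  also have "\<dots> = (\<Sum>b\<in>Basis. sw y (\<lambda>p q. scale (f (b * p)) (slice (coord b) x * q)))"
    by (rule sw_eq_sum_slices) (intro fl)+
  also have "\<dots> = (\<Sum>b\<in>Basis. slice (coord b) x * slice (\<lambda>p. f (b * p)) y)"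
    unfolding slice_def[of "\<lambda>p. f (_ * p)"]
    by (subst lin_sw[of "\<lambda>t. _ * t"], intro lin_intros) (simp add: scale_mult_right)
  finally show ?thesis .
qed

lemma left_coideal_algebra_generated:
  assumes X: "\<And>x f. x \<in> X \<Longrightarrow> form f \<Longrightarrow> slice f x \<in> algebra_generated X"
  shows "left_coideal (algebra_generated X)"
proof (rule left_coidealI)
  let ?A = "algebra_generated X"
  have A: "subalgebra ?A" by (rule subalgebra_algebra_generated)
  then show "subspace ?A" by (simp add: subalgebra_def)
  let ?N = "{x. \<forall>f. form f \<longrightarrow> slice f x \<in> ?A}"
  have "subalgebra ?N"
    unfolding subalgebra_def
  proof (intro conjI ballI)
    have lin: "lin (slice f)" if "form f" for f
      using lin_slice[OF that lin_id] .
    show "subspace ?N"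
      using A by (auto simp: subspace_def subalgebra_def lin_add[OF lin] lin_scale[OF lin] lin_zero[OF lin])
    have "slice f 1 = scale (f 1) 1" if "form f" for f
      unfolding slice_def using that by (subst sw_one) (auto intro!: lin_intros)
    then show "1 \<in> ?N"
      using A by (auto simp: subalgebra_def intro: subspace_scale)
    show "x * y \<in> ?N" if "x \<in> ?N" "y \<in> ?N" for x y
    proof (clarify)
      fix f assume f: "form f"
      have "slice (coord b) x * slice (\<lambda>p. f (b * p)) y \<in> ?A" for b
        using that A form_coord[of b] form_comp[OF f lin_mult_left[OF lin_id]]
        by (auto simp: subalgebra_def)
      then show "slice f (x * y) \<in> ?A"
        using A by (auto simp: slice_mult[OF f] subalgebra_def intro!: subspace_sum)
    qed
  qed
  then have "?A \<subseteq> ?N"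
    using X by (intro algebra_generated_minimal) auto
  then show "slice f x \<in> ?A" if "x \<in> ?A" "form f" for x f
    using that by blast
qed

text \<open>
  The slices of a normalized integral \<open>\<Lambda>\<close> contain \<open>1\<close> in their span, because
  \<open>1 = \<Sum> S(\<Lambda>\<^sub>1)\<Lambda>\<^sub>2 = \<Sum>\<^sub>b S(b)\<Lambda>\<^sub>b\<close> and \<open>S(b)\<close> can be shifted into the slice. Multiplication by \<open>h\<close> with
  \<open>S h = 0\<close> annihilates all slices, hence also \<open>1\<close>.
\<close>

lemma inj_S:
  assumes "semisimple" shows "inj S"
proof -
  obtain \<Lambda> where \<Lambda>: "\<And>h. h * \<Lambda> = scale (\<epsilon> h) \<Lambda>" "\<epsilon> \<Lambda> = 1"
    using semisimple_imp_integral[OF assms] by blast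
  have "h = 0" if "S h = 0" for h
  proof -
    have "1 = sw \<Lambda> (\<lambda>u v. S u * v)"
      by (simp add: sw_antipode_left \<Lambda>(2))
    also have "\<dots> = (\<Sum>b\<in>Basis. S b * slice (coord b) \<Lambda>)"
      by (rule sw_eq_sum_slices) (intro lin_intros)+
    finally have "h * 1 = h * (\<Sum>b\<in>Basis. S b * slice (coord b) \<Lambda>)"
      by (rule arg_cong)
    also have "\<dots> = (\<Sum>b\<in>Basis. (h * S b) * slice (coord b) \<Lambda>)"
      by (simp add: sum_distrib_left mult.assoc)
    also have "\<dots> = (\<Sum>b\<in>Basis. slice (\<lambda>x. coord b (S (h * S b) * x)) \<Lambda>)"
      by (simp add: integral_slice_shift[OF \<Lambda>(1) form_coord])
    also have "\<dots> = (\<Sum>b\<in>Basis. slice (\<lambda>x. 0) \<Lambda>)"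
      using form_scale[OF form_coord, of _ 0 0] by (simp add: S_mult that)
    also have "\<dots> = 0"
      by (simp add: slice_def sw_def case_prod_unfold)
    finally show ?thesis by simp
  qed
  then show ?thesis
    using lin_diff[OF lin_S_raw] by (metis injI right_minus_eq)
qed

lemma surj_S: "semisimple \<Longrightarrow> surj S"
  using linear_inj_imp_surj[OF S_linear inj_S] .

lemma left_coideal_comm_algebra: "left_coideal comm_algebra"
proof -
  have "slice f x \<in> comm_algebra" if "x \<in> {comm a b | a b. True}" "form f" for f x
    using that
    by (auto simp: slice_comm
        intro!: sw_in_subspace subspace_scale subspace_comm_algebra comm_in_comm_algebra)
  then show ?thesis
    unfolding comm_algebra_def by (rule left_coideal_algebra_generated)
qed

end

section \<open>Dimensions of subspaces\<close>

text \<open>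
  Dimensions are compared inside a finitely spanned subspace of an arbitrary space, because below the
  ambient space is the function type \<open>'h \<Rightarrow> 'h\<close>, which need not be finite dimensional.
\<close>

lemma (in vector_space) dim_insert_if:
  assumes "finite F" "U \<subseteq> span F"
  shows "dim (insert x U) = (if x \<in> span U then dim U else Suc (dim U))"
proof -
  obtain C where C: "C \<subseteq> U" "independent C" "U \<subseteq> span C" "card C = dim U"
    using basis_exists by blast
  have fin: "finite C"
    using independent_span_bound[OF assms(1) C(2)] C(1) assms(2) by blast
  have span: "span C = span U"
    using C span_mono span_minimal[OF C(3) subspace_span] by blast
  show ?thesis
  proof (cases "x \<in> span U")
    case True
    then show ?thesis using span_redundant span_eq_dim by metis
  next
    case False
    then have "x \<notin> C" using C(1) span_base by blast
    have "dim (insert x U) = card (insert x C)"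
    proof (rule dim_eq_card)
      show "span (insert x C) = span (insert x U)"
        by (simp add: span_insert span)
      show "independent (insert x C)"
        using False C(2) span by (intro independent_insertI) auto
    qed
    with False fin \<open>x \<notin> C\<close> C(4) show ?thesis by simp
  qed
qed

lemma (in vector_space) dim_mono_finite:
  assumes "finite F" "V \<subseteq> span F" "U \<subseteq> V"
  shows "dim U \<le> dim V"
proof -
  obtain C where C: "C \<subseteq> U" "independent C" "U \<subseteq> span C" "card C = dim U"
    using basis_exists by blast
  obtain B where B: "B \<subseteq> V" "independent B" "V \<subseteq> span B" "card B = dim V"
    using basis_exists by blast
  have "finite B"
    using independent_span_bound[OF assms(1) B(2)] B(1) assms(2) by blast
  from independent_span_bound[OF this C(2)] show ?thesis
    using C(1,4) B(3,4) assms(3) by auto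
qed

context vector_space_pair
begin

lemma dim_image_inj_on:
  assumes f: "Vector_Spaces.linear s1 s2 f" and inj: "inj_on f V" and V: "vs1.subspace V"
  shows "vs2.dim (f ` V) = vs1.dim V"
proof -
  obtain B where B: "B \<subseteq> V" "vs1.independent B" "V \<subseteq> vs1.span B" "card B = vs1.dim V"
    using vs1.basis_exists by blast
  have span: "vs1.span B = V"
    using B vs1.span_minimal[OF B(1) V] by auto
  interpret f: Vector_Spaces.linear s1 s2 f by (rule f)
  have "vs2.dim (f ` V) = card (f ` B)"
  proof (rule vs2.dim_eq_card)
    show "vs2.span (f ` B) = vs2.span (f ` V)"
      unfolding f.span_image span using V by (simp add: f.span_image vs1.span_eq_iff[THEN iffD2])
    show "vs2.independent (f ` B)"
      using f.independent_injective_image[OF B(2)] inj span by simp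
  qed
  also have "\<dots> = card B"
    using inj_on_subset[OF inj B(1)] by (rule card_image)
  finally show ?thesis by (simp add: B(4))
qed

text \<open>
  Passing from \<open>U\<close> to \<open>U + f(Q)\<close> adds at most \<open>dim (Q/P)\<close> dimensions if \<open>f(P) \<subseteq> U\<close>, and exactly as many
  if \<open>P\<close> is the preimage of \<open>U\<close> in \<open>Q\<close>.
\<close>

lemma
  assumes f: "Vector_Spaces.linear s1 s2 f"
    and P: "vs1.subspace P" and Q: "vs1.subspace Q" and PQ: "P \<subseteq> Q"
    and Q_fin: "finite E" "Q \<subseteq> vs1.span E"
    and U: "vs2.subspace U" and U_fin: "finite F" "U \<subseteq> vs2.span F"
    and fP: "\<And>p. p \<in> P \<Longrightarrow> f p \<in> U"
  shows dim_add_image_le: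
      "vs2.dim (vs2.span (U \<union> f ` Q)) + vs1.dim P \<le> vs2.dim U + vs1.dim Q"
    and dim_add_image_eq: "(\<And>q. q \<in> Q \<Longrightarrow> f q \<in> U \<Longrightarrow> q \<in> P) \<Longrightarrow>
      vs2.dim (vs2.span (U \<union> f ` Q)) + vs1.dim P = vs2.dim U + vs1.dim Q"
proof -
  interpret f: Vector_Spaces.linear s1 s2 f by (rule f)
  obtain A where A: "A \<subseteq> P" "vs1.independent A" "P \<subseteq> vs1.span A" "card A = vs1.dim P"
    using vs1.basis_exists by blast
  obtain B where B: "A \<subseteq> B" "B \<subseteq> Q" "vs1.independent B" "Q \<subseteq> vs1.span B"
    using vs1.maximal_independent_subset_extend[of A Q] A PQ by blast
  have finB: "finite B"
    using vs1.independent_span_bound[OF Q_fin(1) B(3)] B(2) Q_fin(2) by blast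
  have dimQ: "vs1.dim Q = card B"
    using B by (metis vs1.basis_card_eq_dim)
  let ?C = "B - A"
  have cardC: "card ?C + vs1.dim P = vs1.dim Q"
    using A(4) B(1) finB dimQ card_mono[OF finB B(1)]
    by (simp add: card_Diff_subset finite_subset)
  have span_eq: "vs2.span (U \<union> f ` Q) = vs2.span (U \<union> f ` ?C)"
  proof
    have "f ` B \<subseteq> vs2.span (U \<union> f ` ?C)"
    proof
      fix z assume "z \<in> f ` B"
      then show "z \<in> vs2.span (U \<union> f ` ?C)"
        using fP A(1) by (cases "z \<in> f ` ?C") (auto intro!: vs2.span_base)
    qed
    then have "vs2.span (f ` B) \<subseteq> vs2.span (U \<union> f ` ?C)"
      by (intro vs2.span_minimal) auto
    then have "f ` Q \<subseteq> vs2.span (U \<union> f ` ?C)"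
      using B(4) by (auto simp: f.span_image)
    then show "vs2.span (U \<union> f ` Q) \<subseteq> vs2.span (U \<union> f ` ?C)"
      by (intro vs2.span_minimal) (auto intro: vs2.span_base)
    show "vs2.span (U \<union> f ` ?C) \<subseteq> vs2.span (U \<union> f ` Q)"
      using B(2) by (intro vs2.span_mono) auto
  qed
  have step: "vs2.dim (vs2.span (U \<union> f ` insert c C)) =
      (if f c \<in> vs2.span (U \<union> f ` C) then vs2.dim (vs2.span (U \<union> f ` C))
       else Suc (vs2.dim (vs2.span (U \<union> f ` C))))" if "finite C" for c C
  proof -
    have "U \<union> f ` C \<subseteq> vs2.span (F \<union> f ` C)"
      using U_fin(2) vs2.span_mono[of F "F \<union> f ` C"] by (auto intro: vs2.span_base)
    from vs2.dim_insert_if[OF _ this, of "f c"] show ?thesis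
      using that U_fin(1) by simp
  qed
  have "vs2.dim (vs2.span (U \<union> f ` C)) \<le> vs2.dim U + card C" if "finite C" for C
    using that
  proof (induction C rule: finite_induct)
    case empty
    then show ?case by simp
  next
    case (insert c C)
    then show ?case using step[of C c] by simp
  qed
  from this[of ?C] show "vs2.dim (vs2.span (U \<union> f ` Q)) + vs1.dim P \<le> vs2.dim U + vs1.dim Q"
    using finB cardC span_eq by simp
  assume inj: "\<And>q. q \<in> Q \<Longrightarrow> f q \<in> U \<Longrightarrow> q \<in> P"
  have "vs2.dim (vs2.span (U \<union> f ` C)) = vs2.dim U + card C" if "finite C" "C \<subseteq> ?C" for C
    using that
  proof (induction C rule: finite_induct)
    case empty
    then show ?case by simp
  next
    case (insert c C)
    have "f c \<notin> vs2.span (U \<union> f ` C)"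
    proof
      assume "f c \<in> vs2.span (U \<union> f ` C)"
      then obtain u w where uw: "f c = u + f w" "u \<in> U" "w \<in> vs1.span C"
        unfolding vs2.span_Un f.span_image vs2.span_eq_iff[THEN iffD2, OF U] by blast
      have sub: "vs1.span C \<subseteq> Q"
        using insert.prems B(2) Q by (intro vs1.span_minimal) auto
      have "f (c - w) \<in> U"
        using uw by (simp add: f.diff)
      moreover have "c - w \<in> Q"
        using insert.prems B(2) sub uw(3) Q by (intro vs1.subspace_diff) auto
      ultimately have "c - w \<in> vs1.span A"
        using inj A(3) by blast
      then have "(c - w) + w \<in> vs1.span (A \<union> C)"
        using uw(3) vs1.span_mono[of A "A \<union> C"] vs1.span_mono[of C "A \<union> C"]
        by (intro vs1.span_add) auto
      then have "c \<in> vs1.span (B - {c})"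
        using insert.prems insert.hyps B(1) vs1.span_mono[of "A \<union> C" "B - {c}"] by auto
      then show False
        using B(3) insert.prems by (auto simp: vs1.dependent_def)
    qed
    then show ?case using step[of C c] insert by simp
  qed
  from this[of ?C] show "vs2.dim (vs2.span (U \<union> f ` Q)) + vs1.dim P = vs2.dim U + vs1.dim Q"
    using finB cardC span_eq by simp
qed

end

section \<open>The dimension formula\<close>

lemma sum_fun_apply:
  fixes f :: "'i \<Rightarrow> 'x \<Rightarrow> 'y::comm_monoid_add"
  shows "(\<Sum>i\<in>A. f i) x = (\<Sum>i\<in>A. f i x)"
  by (induction A rule: infinite_finite_induct) auto

context finite_hopf_algebra
begin

text \<open>
  The tensor square \<open>H \<otimes> H\<close> is modelled by the functions \<open>z :: 'h \<Rightarrow> 'h\<close> that vanish outside the basis,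
  with \<open>z\<close> standing for \<open>\<Sum>\<^sub>b b \<otimes> z(b)\<close>. Thus \<open>act\<close> is multiplication on the right leg and
  \<open>funs Basis K\<close> is \<open>H \<otimes> K\<close>.
\<close>

definition fscale :: "'k \<Rightarrow> ('h \<Rightarrow> 'h) \<Rightarrow> ('h \<Rightarrow> 'h)"
  where "fscale c z = (\<lambda>b. scale c (z b))"

definition act :: "'h \<Rightarrow> ('h \<Rightarrow> 'h) \<Rightarrow> ('h \<Rightarrow> 'h)"
  where "act h z = (\<lambda>b. h * z b)"

definition funs :: "'h set \<Rightarrow> 'h set \<Rightarrow> ('h \<Rightarrow> 'h) set"
  where "funs A K = {z. (\<forall>b\<in>A. z b \<in> K) \<and> (\<forall>b. b \<notin> A \<longrightarrow> z b = 0)}"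

definition pure_tensor :: "'h \<Rightarrow> 'h \<Rightarrow> ('h \<Rightarrow> 'h)"
  where "pure_tensor x y = (\<lambda>b. scale (coord b x) y)"

sublocale fv: vector_space fscale
  by unfold_locales (auto simp: fscale_def scale_right_distrib scale_left_distrib)

sublocale hv: vector_space_pair scale fscale ..

sublocale ff: vector_space_pair fscale fscale ..

lemma coord_Basis: "b \<in> Basis \<Longrightarrow> coord b' b = (if b' = b then 1 else 0)"
  unfolding coord_def using representation_basis[OF independent_Basis] by auto

lemma coord_outside: "b \<notin> Basis \<Longrightarrow> coord b x = 0"
  unfolding coord_def using representation_ne_zero by blast

lemma act_one: "act 1 z = z"
  and act_mult: "act (g * h) z = act g (act h z)"
  by (simp_all add: act_def mult.assoc)

lemma act_add_right: "act h (z + w) = act h z + act h w"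
  and act_fscale: "act h (fscale c z) = fscale c (act h z)"
  and act_zero_right: "act h 0 = 0"
  by (auto simp: act_def fscale_def distrib_left scale_mult_right)

lemma linear_act_left: "Vector_Spaces.linear scale fscale (\<lambda>h. act h z)"
  by unfold_locales (auto simp: act_def fscale_def distrib_right scale_mult_left)

lemma subspace_act_preimage:
  assumes "fv.subspace U" shows "subspace {h. act h z \<in> U}"
proof -
  interpret f: Vector_Spaces.linear scale fscale "\<lambda>h. act h z" by (rule linear_act_left)
  show ?thesis by (rule f.subspace_linear_preimage[OF assms])
qed

lemma subspace_funs: "subspace K \<Longrightarrow> fv.subspace (funs A K)"
  by (auto simp: fv.subspace_def funs_def fscale_def subspace_def)

lemma funs_mono: "K \<subseteq> L \<Longrightarrow> funs A K \<subseteq> funs A L"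
  by (auto simp: funs_def)

lemma funs_finite:
  assumes "finite A" obtains F where "finite F" "funs A UNIV \<subseteq> fv.span F"
proof
  let ?d = "\<lambda>b x. (\<lambda>b'. if b' = b then x else 0) :: 'h \<Rightarrow> 'h"
  let ?F = "(\<lambda>(b, x). ?d b x) ` (A \<times> Basis)"
  show "finite ?F" using assms finite_Basis by auto
  show "funs A UNIV \<subseteq> fv.span ?F"
  proof
    fix z assume z: "z \<in> funs A UNIV"
    have "z = (\<Sum>b\<in>A. \<Sum>x\<in>Basis. fscale (coord x (z b)) (?d b x))"
    proof
      fix b'
      have "(\<Sum>b\<in>A. \<Sum>x\<in>Basis. fscale (coord x (z b)) (?d b x)) b' =
          (\<Sum>b\<in>A. \<Sum>x\<in>Basis. fscale (coord x (z b)) (?d b x) b')"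
        by (simp add: sum_fun_apply)
      also have "\<dots> = (\<Sum>b\<in>A. if b' = b then z b else 0)"
        by (intro sum.cong) (auto simp: fscale_def sum_coord)
      also have "\<dots> = z b'"
        using z assms by (auto simp: funs_def)
      finally show "z b' = (\<Sum>b\<in>A. \<Sum>x\<in>Basis. fscale (coord x (z b)) (?d b x)) b'" ..
    qed
    also have "\<dots> \<in> fv.span ?F"
      by (intro fv.span_sum fv.span_scale fv.span_base) auto
    finally show "z \<in> fv.span ?F" .
  qed
qed

lemma dim_funs:
  assumes "finite A" and K: "subspace K"
  shows "fv.dim (funs A K) = card A * dim K"
  using assms(1)
proof (induction A rule: finite_induct)
  case empty
  have "funs {} K = {0}"
    by (auto simp: funs_def)
  moreover have "fv.dim {0} = card ({} :: ('h \<Rightarrow> 'h) set)"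
    by (rule fv.dim_eq_card) (simp_all add: fv.span_eq_iff[THEN iffD2] fv.independent_empty)
  ultimately show ?case by simp
next
  case (insert a A)
  let ?d = "\<lambda>x. (\<lambda>b. if b = a then x else 0) :: 'h \<Rightarrow> 'h"
  obtain F where F: "finite F" "funs A UNIV \<subseteq> fv.span F"
    using funs_finite[OF insert.hyps(1)] by blast
  have lin: "Vector_Spaces.linear scale fscale ?d"
    by unfold_locales (auto simp: fscale_def)
  have "funs (insert a A) K = fv.span (funs A K \<union> ?d ` K)"
  proof
    show "fv.span (funs A K \<union> ?d ` K) \<subseteq> funs (insert a A) K"
      using K by (intro fv.span_minimal subspace_funs) (auto simp: funs_def subspace_0)
    show "funs (insert a A) K \<subseteq> fv.span (funs A K \<union> ?d ` K)"
    proof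
      fix z assume z: "z \<in> funs (insert a A) K"
      have "z = z(a := 0) + ?d (z a)" by auto
      moreover have "z(a := 0) \<in> funs A K" "?d (z a) \<in> ?d ` K"
        using z insert.hyps by (auto simp: funs_def)
      ultimately show "z \<in> fv.span (funs A K \<union> ?d ` K)"
        by (metis UnI1 UnI2 fv.span_add fv.span_base)
    qed
  qed
  moreover have "fv.dim (fv.span (funs A K \<union> ?d ` K)) + dim {0} = fv.dim (funs A K) + dim K"
  proof (rule hv.dim_add_image_eq[OF lin subspace_single_0 K _ finite_Basis _ _ F(1)])
    show "funs A K \<subseteq> fv.span F"
      using F(2) funs_mono[of K UNIV A] by auto
    show "q \<in> {0}" if "?d q \<in> funs A K" for q
      using that insert.hyps by (auto simp: funs_def dest: fun_cong[of _ _ a] spec[of _ a])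
  qed (use K in \<open>auto simp: subspace_0 span_Basis subspace_funs fv.subspace_0 fun_eq_iff
        intro!: fv.subspace_0[OF subspace_funs[OF K], unfolded zero_fun_def]\<close>)
  ultimately show ?case using insert by simp
qed

abbreviation tensors :: "('h \<Rightarrow> 'h) set"
  where "tensors \<equiv> funs Basis UNIV"

lemma dim_mono_tensors: "V \<subseteq> tensors \<Longrightarrow> U \<subseteq> V \<Longrightarrow> fv.dim U \<le> fv.dim V"
  using funs_finite[OF finite_Basis] fv.dim_mono_finite by (metis order_trans)

lemma subspace_tensors: "fv.subspace tensors"
  by (simp add: subspace_funs)

definition generated :: "('h \<Rightarrow> 'h) set \<Rightarrow> ('h \<Rightarrow> 'h) set"
  where "generated U = fv.span {act h z | h z. z \<in> U}"

lemma subspace_generated: "fv.subspace (generated U)"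
  by (simp add: generated_def)

lemma act_in_generated: "z \<in> U \<Longrightarrow> act h z \<in> generated U"
  unfolding generated_def by (auto intro: fv.span_base)

lemma generated_minimal:
  "fv.subspace W \<Longrightarrow> (\<And>h z. z \<in> U \<Longrightarrow> act h z \<in> W) \<Longrightarrow> generated U \<subseteq> W"
  unfolding generated_def by (intro fv.span_minimal) auto

lemma generated_span_minimal:
  assumes W: "fv.subspace W" and "\<And>h z. z \<in> X \<Longrightarrow> act h z \<in> W"
  shows "generated (fv.span X) \<subseteq> W"
proof (rule generated_minimal[OF W])
  fix h z assume "z \<in> fv.span X"
  then show "act h z \<in> W"
  proof (induction rule: fv.span_induct_alt)
    case base
    show ?case unfolding act_zero_right by (rule fv.subspace_0[OF W])
  next
    case (step c x y)
    show ?case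
      unfolding act_add_right act_fscale
      by (rule fv.subspace_add[OF W fv.subspace_scale[OF W assms(2)[OF step(1)]] step(2)])
  qed
qed

lemma generated_tensors: "U \<subseteq> tensors \<Longrightarrow> generated U \<subseteq> tensors"
  by (rule generated_minimal[OF subspace_tensors]) (auto simp: funs_def act_def)

definition left_span :: "'h set \<Rightarrow> 'h set"
  where "left_span I = span {h * x | h x. x \<in> I}"

lemma subspace_left_span: "subspace (left_span I)"
  by (simp add: left_span_def)

lemma mult_in_left_span: "x \<in> I \<Longrightarrow> h * x \<in> left_span I"
  unfolding left_span_def by (auto intro: span_base)

lemma left_span_minimal: "subspace W \<Longrightarrow> (\<And>h x. x \<in> I \<Longrightarrow> h * x \<in> W) \<Longrightarrow> left_span I \<subseteq> W"
  unfolding left_span_def by (intro span_minimal) auto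

definition left_ideal_in :: "'h set \<Rightarrow> 'h set \<Rightarrow> bool"
  where "left_ideal_in M I \<longleftrightarrow> subspace I \<and> I \<subseteq> M \<and> (\<forall>m\<in>M. \<forall>x\<in>I. m * x \<in> I)"

definition submodule :: "'h set \<Rightarrow> ('h \<Rightarrow> 'h) set \<Rightarrow> bool"
  where "submodule M U \<longleftrightarrow> fv.subspace U \<and> U \<subseteq> tensors \<and> (\<forall>m\<in>M. \<forall>z\<in>U. act m z \<in> U)"

text \<open>
  \<open>J\<close> plays the part of the annihilator of \<open>z\<close> modulo \<open>U\<close>: as \<open>HJz \<subseteq> HU\<close>, adding \<open>Hz\<close> to \<open>HU\<close> costs at
  most \<open>dim (H/HJ)\<close>.
\<close>

lemma generated_add_cyclic:
  assumes U: "U \<subseteq> tensors" and z: "z \<in> tensors"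
    and J: "\<And>x. x \<in> J \<Longrightarrow> act x z \<in> U"
  shows "fv.dim (generated (fv.span (U \<union> (\<lambda>m. act m z) ` M))) + dim (left_span J)
    \<le> fv.dim (generated U) + card Basis"
proof -
  let ?f = "\<lambda>h. act h z"
  obtain F where F: "finite F" "tensors \<subseteq> fv.span F"
    using funs_finite[OF finite_Basis] by blast
  have ft: "act h z \<in> tensors" for h
    using z by (auto simp: funs_def act_def)
  have "left_span J \<subseteq> {h. act h z \<in> generated U}"
    using J
    by (intro left_span_minimal subspace_act_preimage subspace_generated)
      (auto simp: act_mult intro!: act_in_generated)
  then have "fv.dim (fv.span (generated U \<union> ?f ` UNIV)) + dim (left_span J) \<le>
      fv.dim (generated U) + dim UNIV"
    using generated_tensors[OF U] F
    by (intro hv.dim_add_image_le[OF linear_act_left subspace_left_span subspace_UNIV _ finite_Basis _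
          subspace_generated F(1)]) (auto simp: span_Basis)
  moreover have "fv.dim (generated (fv.span (U \<union> ?f ` M))) \<le>
      fv.dim (fv.span (generated U \<union> ?f ` UNIV))"
  proof (rule dim_mono_tensors)
    show "fv.span (generated U \<union> ?f ` UNIV) \<subseteq> tensors"
      using generated_tensors[OF U] ft by (intro fv.span_minimal subspace_tensors) auto
    show "generated (fv.span (U \<union> ?f ` M)) \<subseteq> fv.span (generated U \<union> ?f ` UNIV)"
      by (rule generated_span_minimal)
        (auto simp flip: act_mult intro: fv.span_base act_in_generated)
  qed
  ultimately show ?thesis by simp
qed

lemma submodule_add_cyclic:
  assumes M: "subalgebra M" and U: "submodule M U" and z: "z \<in> tensors" and J: "left_ideal_in M J"
  shows "submodule M (fv.span (U \<union> (\<lambda>m. act m z) ` J))"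
  unfolding submodule_def
proof (intro conjI ballI)
  let ?V = "fv.span (U \<union> (\<lambda>m. act m z) ` J)"
  show "?V \<subseteq> tensors"
    using U z by (intro fv.span_minimal subspace_tensors) (auto simp: submodule_def funs_def act_def)
  fix m v assume m: "m \<in> M" and "v \<in> ?V"
  from this(2) show "act m v \<in> ?V"
  proof (induction rule: fv.span_induct_alt)
    case base
    show ?case unfolding act_zero_right by (rule fv.span_zero)
  next
    case (step c x y)
    have "act m x \<in> U \<union> (\<lambda>m. act m z) ` J"
      using step(1) U J m by (auto simp: submodule_def left_ideal_in_def simp flip: act_mult)
    then show ?case
      unfolding act_add_right act_fscale
      by (intro fv.span_add[OF fv.span_scale step(2)] fv.span_base)
  qed
qed auto

lemma dim_add_cyclic:
  assumes U: "submodule M U" and z: "z \<in> tensors" and J: "subspace J" and Q: "subspace Q"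
    and "J \<subseteq> Q" "\<And>q. q \<in> Q \<Longrightarrow> act q z \<in> U \<longleftrightarrow> q \<in> J"
  shows "fv.dim (fv.span (U \<union> (\<lambda>m. act m z) ` Q)) + dim J = fv.dim U + dim Q"
proof -
  obtain F where F: "finite F" "tensors \<subseteq> fv.span F"
    using funs_finite[OF finite_Basis] by blast
  show ?thesis
    using assms F
    by (intro hv.dim_add_image_eq[OF linear_act_left J Q _ finite_Basis _ _ F(1)])
      (auto simp: submodule_def span_Basis)
qed

text \<open>
  The bound \<open>c\<close> on cyclic modules \<open>M/I\<close> extends to all extensions \<open>U \<subseteq> V\<close>: choose \<open>y \<in> V - U\<close> with
  annihilator \<open>I\<close> modulo \<open>U\<close>, so that \<open>(U + My)/U\<close> is \<open>M/I\<close>, and continue with \<open>U + My\<close>.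
\<close>

lemma dim_generated_growth:
  assumes M: "subalgebra M"
    and c: "\<And>I. left_ideal_in M I \<Longrightarrow>
      real (card Basis) - real (dim (left_span I)) \<le> c * (real (dim M) - real (dim I))"
    and "submodule M U" "submodule M V" "U \<subseteq> V"
  shows "real (fv.dim (generated V)) - real (fv.dim (generated U)) \<le>
    c * (real (fv.dim V) - real (fv.dim U))"
  using assms(3-)
proof (induction "fv.dim V - fv.dim U" arbitrary: U rule: less_induct)
  case less
  show ?case
  proof (cases "U = V")
    case True
    then show ?thesis by simp
  next
    case False
    then obtain y where y: "y \<in> V" "y \<notin> U"
      using less.prems by blast
    have yt: "y \<in> tensors"
      using y less.prems by (auto simp: submodule_def)
    define I where "I = {m \<in> M. act m y \<in> U}"
    have MM: "subspace M" "1 \<in> M" "\<And>x y. x \<in> M \<Longrightarrow> y \<in> M \<Longrightarrow> x * y \<in> M"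
      using M by (auto simp: subalgebra_def)
    have U: "fv.subspace U" and V: "fv.subspace V"
      using less.prems by (auto simp: submodule_def)
    have "subspace {m. act m y \<in> U}"
      using U by (rule subspace_act_preimage)
    then have I: "left_ideal_in M I"
      using less.prems(1) MM
      by (auto simp: left_ideal_in_def I_def submodule_def act_mult subspace_def)
    let ?W = "fv.span (U \<union> (\<lambda>m. act m y) ` M)"
    have idM: "left_ideal_in M M"
      using MM by (auto simp: left_ideal_in_def)
    have W: "submodule M ?W"
      by (rule submodule_add_cyclic[OF M less.prems(1) yt idM])
    have dimW: "fv.dim ?W + dim I = fv.dim U + dim M"
      using I MM(1) by (intro dim_add_cyclic[OF less.prems(1) yt]) (auto simp: left_ideal_in_def I_def)
    have WV: "?W \<subseteq> V"
      using less.prems y(1) V by (intro fv.span_minimal) (auto simp: submodule_def)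
    have "1 \<notin> I"
      using y(2) by (simp add: I_def act_one)
    then have "I \<subset> M"
      using MM(2) by (auto simp: I_def)
    then have "dim I < dim M"
      using I MM(1) by (intro dim_psubset) (simp add: left_ideal_in_def span_eq_iff[THEN iffD2])
    then have "fv.dim V - fv.dim ?W < fv.dim V - fv.dim U"
      using dimW dim_mono_tensors[OF _ WV] less.prems by (auto simp: submodule_def)
    from less.hyps[OF this W less.prems(2) WV]
    have "real (fv.dim (generated V)) - real (fv.dim (generated ?W)) \<le>
        c * (real (fv.dim V) - real (fv.dim ?W))" .
    moreover have "fv.dim (generated ?W) + dim (left_span I) \<le> fv.dim (generated U) + card Basis"
      using less.prems(1) yt by (intro generated_add_cyclic) (auto simp: submodule_def I_def)
    ultimately have "real (fv.dim (generated V)) - real (fv.dim (generated U)) \<le>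
        c * (real (fv.dim V) - real (fv.dim ?W)) + c * (real (dim M) - real (dim I))"
      using c[OF I] by linarith
    also have "\<dots> = c * ((real (fv.dim V) - real (fv.dim ?W)) + (real (dim M) - real (dim I)))"
      by (simp only: distrib_left)
    also have "(real (fv.dim V) - real (fv.dim ?W)) + (real (dim M) - real (dim I)) =
        real (fv.dim V) - real (fv.dim U)"
      using arg_cong[OF dimW, of real] by (simp del: fv.dim_span)
    finally show ?thesis .
  qed
qed

text \<open>
  The Galois map \<open>x \<otimes> y \<mapsto> \<Sum> xy\<^sub>1 \<otimes> y\<^sub>2\<close>. It turns the diagonal \<open>H\<close>-module structure
  \<open>h(x \<otimes> y) = \<Sum> xS(h\<^sub>1) \<otimes> h\<^sub>2y\<close> into multiplication on the right leg, so only the latter is used.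
\<close>

definition galois_map :: "('h \<Rightarrow> 'h) \<Rightarrow> ('h \<Rightarrow> 'h)"
  where "galois_map z = (\<lambda>b'. \<Sum>b\<in>Basis. slice (\<lambda>u. coord b' (b * u)) (z b))"

lemma form_coord_mult: "form (\<lambda>u. coord b' (b * u))"
  by (rule form_comp[OF form_coord]) (intro lin_intros)

lemma form_coord_mult_S: "form (\<lambda>u. coord b' (b * S u))"
  by (rule form_comp[OF form_coord]) (intro lin_intros)

lemma linear_galois_map: "Vector_Spaces.linear fscale fscale galois_map"
proof -
  note lin = lin_slice[OF form_coord_mult lin_id]
  show ?thesis
    by unfold_locales
      (auto simp: galois_map_def fscale_def lin_add[OF lin] lin_scale[OF lin] sum.distrib scale_sum_right)
qed

lemma galois_map_tensors: "galois_map z \<in> tensors"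
  by (auto simp: galois_map_def funs_def coord_outside slice_def sw_def case_prod_unfold)

lemma sum_coord_lin:
  assumes "lin f" shows "(\<Sum>b\<in>Basis. scale (coord b x) (f b)) = f x"
proof -
  have "f x = f (\<Sum>b\<in>Basis. scale (coord b x) b)" by (simp add: sum_coord)
  then show ?thesis by (simp only: lin_sum[OF assms] lin_scale[OF assms])
qed

text \<open>
  In terms of tensors, a bilinear map applied to the image of \<open>\<Sum> b \<otimes> y\<close> is \<open>\<Sum> F(by\<^sub>1, y\<^sub>2)\<close>.
\<close>

lemma bilinear_galois_map:
  assumes F: "\<And>y. lin (\<lambda>x. F x y)" "\<And>x. lin (F x)"
  shows "(\<Sum>b'\<in>Basis. F b' (galois_map z b')) = (\<Sum>b\<in>Basis. sw (z b) (\<lambda>u v. F (b * u) v))"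
proof -
  have "F b' (galois_map z b') = (\<Sum>b\<in>Basis. sw (z b) (\<lambda>u v. scale (coord b' (b * u)) (F b' v)))" for b'
    by (simp add: galois_map_def lin_sum[OF F(2)] slice_def lin_sw[OF F(2)] lin_scale[OF F(2)])
  then have "(\<Sum>b'\<in>Basis. F b' (galois_map z b')) =
      (\<Sum>b'\<in>Basis. \<Sum>b\<in>Basis. sw (z b) (\<lambda>u v. scale (coord b' (b * u)) (F b' v)))"
    by simp
  also have "\<dots> = (\<Sum>b\<in>Basis. \<Sum>b'\<in>Basis. sw (z b) (\<lambda>u v. scale (coord b' (b * u)) (F b' v)))"
    by (rule sum.swap)
  finally show ?thesis
    by (simp add: sw_sum sum_coord_lin[OF F(1)])
qed

text \<open>
  The coefficient at \<open>c\<close> of \<open>\<Sum> xS(y\<^sub>1) \<otimes> y\<^sub>2\<close>, the inverse of the Galois map.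
\<close>

definition galois_inverse :: "'h \<Rightarrow> 'h \<Rightarrow> 'h \<Rightarrow> 'h"
  where "galois_inverse c x y = slice (\<lambda>u. coord c (x * S u)) y"

lemma lin_galois_inverse: "lin (\<lambda>x. galois_inverse c x y)" "lin (galois_inverse c x)"
  unfolding galois_inverse_def slice_def by (intro lin_intros form_comp[OF form_coord])+

lemma galois_inverse_galois_map:
  assumes z: "z \<in> tensors"
  shows "(\<Sum>b'\<in>Basis. galois_inverse c b' (galois_map z b')) = z c"
proof -
  note fl = lin_intros form_comp[OF form_coord]
  have "(\<Sum>b'\<in>Basis. galois_inverse c b' (galois_map z b')) = (\<Sum>b\<in>Basis. sw (z b) (\<lambda>u v. galois_inverse c (b * u) v))"
    by (rule bilinear_galois_map) (intro lin_galois_inverse)+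
  also have "\<dots> = (\<Sum>b\<in>Basis. scale (coord c b) (z b))"
  proof (rule sum.cong[OF refl])
    fix b
    have "sw (z b) (\<lambda>u v. galois_inverse c (b * u) v) =
        sw (z b) (\<lambda>s v. sw s (\<lambda>u w. scale (coord c (b * (u * S w))) v))"
      unfolding galois_inverse_def slice_def mult.assoc by (rule sw_coassoc[symmetric]) (intro fl)+
    also have "\<dots> = scale (coord c b) (z b)"
    proof (rule sw_cancel_first)
      fix n v
      have "lin (\<lambda>t. scale (coord c (b * t)) v)"
        by (intro fl)
      from sw_antipode_right_lin[OF this]
      show "sw n (\<lambda>u w. scale (coord c (b * (u * S w))) v) = scale (\<epsilon> n) (scale (coord c b) v)"
        by simp
    qed (intro lin_intros)
    finally show "sw (z b) (\<lambda>u v. galois_inverse c (b * u) v) = scale (coord c b) (z b)" .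
  qed
  also have "\<dots> = (\<Sum>b\<in>Basis. if b = c then z b else 0)"
    by (rule sum.cong) (auto simp: coord_Basis)
  also have "\<dots> = z c"
    using z finite_Basis by (auto simp: funs_def)
  finally show ?thesis .
qed

lemma inj_on_galois_map: "inj_on galois_map tensors"
proof (rule inj_onI)
  fix z w assume "z \<in> tensors" "w \<in> tensors" "galois_map z = galois_map w"
  then show "z = w"
    using galois_inverse_galois_map by (metis ext)
qed

text \<open>
  \<open>h \<cdot> \<Sum> xy\<^sub>1 \<otimes> y\<^sub>2\<close> is the image of \<open>\<Sum> xS(h\<^sub>1) \<otimes> h\<^sub>2y\<close>, because \<open>\<Sum> S(h\<^sub>1)h\<^sub>2 \<otimes> h\<^sub>3 = 1 \<otimes> h\<close>.
\<close>

lemma act_galois_map: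
  "act h (galois_map z) = galois_map (\<lambda>c. \<Sum>b\<in>Basis. slice (\<lambda>u. coord c (b * S u)) h * z b)"
proof
  fix b'
  note fl = lin_intros form_comp[OF form_coord]
  define F where "F x y = slice (\<lambda>u. coord b' (x * u)) y" for x y
  have F: "lin (\<lambda>x. F x y)" "lin (F x)" for x y
    unfolding F_def slice_def by (intro fl)+
  have "galois_map (\<lambda>c. \<Sum>b\<in>Basis. slice (\<lambda>u. coord c (b * S u)) h * z b) b' =
      (\<Sum>c\<in>Basis. \<Sum>b\<in>Basis. sw h (\<lambda>u v. scale (coord c (b * S u)) (F c (v * z b))))"
    by (simp add: galois_map_def lin_sum[OF F(2), unfolded F_def] F_def)
      (simp add: lin_sw[OF lin_comp[OF F(2) lin_mult_right[OF lin_id]], unfolded F_def]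
        slice_def[of "\<lambda>u. coord _ (_ * S u)"] lin_scale[OF F(2), unfolded F_def] scale_mult_left)
  also have "\<dots> = (\<Sum>b\<in>Basis. \<Sum>c\<in>Basis. sw h (\<lambda>u v. scale (coord c (b * S u)) (F c (v * z b))))"
    by (rule sum.swap)
  also have "\<dots> = (\<Sum>b\<in>Basis. sw h (\<lambda>u v. F (b * S u) (v * z b)))"
    by (simp add: sw_sum sum_coord_lin[OF F(1)])
  also have "\<dots> = (\<Sum>b\<in>Basis. h * F b (z b))"
  proof (rule sum.cong[OF refl])
    fix b
    define T where "T x y w = sw (z b) (\<lambda>p q. scale (coord b' (b * (x * y) * p)) (w * q))" for x y w
    have T: "lin (\<lambda>x. T x y w)" "lin (\<lambda>y. T x y w)" "lin (\<lambda>w. T x y w)" for x y w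
      unfolding T_def by (intro fl)+
    have "F (b * S u) (v * z b) = sw v (\<lambda>y w. T (S u) y w)" for u v
      unfolding F_def T_def slice_def by (subst sw_mult, (intro fl)+) (simp add: mult.assoc)
    then have "sw h (\<lambda>u v. F (b * S u) (v * z b)) = sw h (\<lambda>u v. sw v (\<lambda>y w. T (S u) y w))"
      by simp
    also have "\<dots> = sw h (\<lambda>v w. sw v (\<lambda>u y. T (S u) y w))"
      by (rule sw_coassoc[symmetric]) (intro T lin_comp[OF T(1)] lin_intros)+
    also have "\<dots> = sw (z b) (\<lambda>p q. scale (coord b' (b * p)) (h * q))"
    proof (rule sw_cancel_first)
      fix n w
      have "lin (\<lambda>t. sw (z b) (\<lambda>p q. scale (coord b' (b * t * p)) (w * q)))"
        by (intro fl)
      from sw_antipode_left_lin[OF this]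
      show "sw n (\<lambda>u y. T (S u) y w) =
          scale (\<epsilon> n) (sw (z b) (\<lambda>p q. scale (coord b' (b * p)) (w * q)))"
        by (simp add: T_def)
    qed (intro fl)
    also have "\<dots> = h * F b (z b)"
      unfolding F_def slice_def
      by (subst lin_sw[of "\<lambda>t. h * t"], intro lin_intros) (simp add: scale_mult_right)
    finally show "sw h (\<lambda>u v. F (b * S u) (v * z b)) = h * F b (z b)" .
  qed
  also have "\<dots> = act h (galois_map z) b'"
    by (simp add: act_def galois_map_def F_def sum_distrib_left)
  finally show "act h (galois_map z) b' =
      galois_map (\<lambda>c. \<Sum>b\<in>Basis. slice (\<lambda>u. coord c (b * S u)) h * z b) b'" ..
qed

lemma act_galois_map_in:
  assumes "\<And>b. b \<in> Basis \<Longrightarrow> z b \<in> K" and L: "subspace L"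
    and "\<And>f x. form f \<Longrightarrow> x \<in> K \<Longrightarrow> slice f h * x \<in> L"
  shows "act h (galois_map z) \<in> galois_map ` funs Basis L"
  unfolding act_galois_map using assms(1,3) form_coord_mult_S
  by (intro imageI) (auto simp: funs_def slice_def[of "\<lambda>u. 0"] coord_outside sw_def case_prod_unfold
      intro!: subspace_sum[OF L])

text \<open>
  If a subspace contains all slices of some \<open>m \<noteq> 0\<close>, then the left ideal that it generates contains
  \<open>\<Sum> f(m\<^sub>1)S(m\<^sub>2)m\<^sub>3 = f(m)1\<close>, which is nonzero for a suitable form \<open>f\<close>.
\<close>

lemma slices_in_left_ideal_trivial:
  assumes I: "\<And>f. form f \<Longrightarrow> slice f m \<in> I" and "m \<noteq> 0"
  shows "left_span I = UNIV"
proof -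
  obtain c where c: "coord c m \<noteq> 0"
  proof (rule ccontr)
    assume "\<not> thesis"
    then have "coord c m = 0" for c using that by blast
    then have "m = 0" using sum_coord[of m] by simp
    with assms(2) show False by simp
  qed
  note fl = lin_intros form_comp[OF form_coord]
  define F where "F x y z = scale (coord c x) (S y * z)" for x y z
  have F: "lin (\<lambda>x. F x y z)" "lin (\<lambda>y. F x y z)" "lin (\<lambda>z. F x y z)" for x y z
    unfolding F_def by (intro fl)+
  have "sw m (\<lambda>s z. sw s (\<lambda>x y. F x y z)) = scale (coord c m) 1"
  proof (rule sw_cancel_last)
    fix n x
    have "lin (\<lambda>t. scale (coord c x) t)"
      by (intro fl)
    from sw_antipode_left_lin[OF this]
    show "sw n (\<lambda>y z. F x y z) = scale (\<epsilon> n) (scale (coord c x) 1)" by (simp add: F_def)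
  qed (intro F fl)+
  moreover have "sw m (\<lambda>s z. sw s (\<lambda>x y. F x y z)) =
      (\<Sum>b\<in>Basis. sw b (\<lambda>x y. F x y (slice (coord b) m)))"
    by (rule sw_eq_sum_slices) (intro F fl)+
  moreover have "sw b (\<lambda>x y. F x y (slice (coord b) m)) \<in> left_span I" for b
    unfolding F_def
    by (intro sw_in_subspace subspace_left_span subspace_scale mult_in_left_span I form_coord)
  ultimately have "scale (coord c m) 1 \<in> left_span I"
    by (metis (no_types, lifting) subspace_sum[OF subspace_left_span])
  then have "scale (inverse (coord c m)) (scale (coord c m) 1) \<in> left_span I"
    by (rule subspace_scale[OF subspace_left_span])
  then have one: "1 \<in> left_span I"
    using c by simp
  have "h * x \<in> left_span I" if "x \<in> left_span I" for h x
  proof -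
    have "left_span I \<subseteq> {x. h * x \<in> left_span I}"
    proof (rule left_span_minimal)
      show "subspace {x. h * x \<in> left_span I}"
        using subspace_left_span[of I] by (simp add: subspace_def distrib_left scale_mult_right)
      show "g * x \<in> {x. h * x \<in> left_span I}" if "x \<in> I" for g x
        using mult_in_left_span[OF that, of "h * g"] by (simp add: mult.assoc)
    qed
    with that show ?thesis by blast
  qed
  from this[OF one] show ?thesis by auto
qed

text \<open>
  Applying the inverse of the Galois map to \<open>1 \<otimes> m\<close> gives \<open>\<Sum> S(m\<^sub>1) \<otimes> m\<^sub>2 \<in> H \<otimes> I\<close>. As \<open>S\<close> is injective,
  each linear form is of the form \<open>g \<circ> S\<close>, so all slices of \<open>m\<close> lie in \<open>I\<close>.
\<close>

lemma slice_in_if_pure_tensor_in_galois_image: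
  assumes S: "inj S" and I: "subspace I" and m: "pure_tensor 1 m \<in> galois_map ` funs Basis I" and f: "form f"
  shows "slice f m \<in> I"
proof -
  obtain z where z: "\<And>b. b \<in> Basis \<Longrightarrow> z b \<in> I" "z \<in> tensors" "pure_tensor 1 m = galois_map z"
    using m by (auto simp: funs_def)
  have slice_S: "slice (\<lambda>u. coord c (S u)) m \<in> I" if "c \<in> Basis" for c
  proof -
    have "galois_inverse c 1 m = galois_inverse c (\<Sum>b\<in>Basis. scale (coord b 1) b) m"
      by (simp add: sum_coord)
    also have "\<dots> = (\<Sum>b\<in>Basis. galois_inverse c b (pure_tensor 1 m b))"
      by (simp only: pure_tensor_def lin_sum[OF lin_galois_inverse(1)] lin_scale[OF lin_galois_inverse(1)]
          lin_scale[OF lin_galois_inverse(2)])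
    also have "\<dots> = z c"
      by (simp only: z(3) galois_inverse_galois_map[OF z(2)])
    finally show ?thesis
      using z(1)[OF that] by (simp add: galois_inverse_def)
  qed
  interpret hh: vector_space_pair scale scale ..
  obtain T where T: "Vector_Spaces.linear scale scale T" "T \<circ> S = id"
    using hh.linear_injective_left_inverse[OF S_linear S] by blast
  have lin_T: "lin T"
    using T(1) by (simp add: lin_def Vector_Spaces.linear_def module_hom_def module_hom_axioms_def)
  have "scale (f x) y = (\<Sum>c\<in>Basis. scale (f (T c)) (scale (coord c (S x)) y))" for x y
  proof -
    have "lin (\<lambda>t. scale (f (T t)) y)"
      by (intro lin_intros form_comp[OF f] lin_T)
    from sum_coord_lin[OF this, of "S x"] show ?thesis
      using fun_cong[OF T(2), of x] by (simp add: mult.commute)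
  qed
  then have "slice f m = sw m (\<lambda>x y. \<Sum>c\<in>Basis. scale (f (T c)) (scale (coord c (S x)) y))"
    unfolding slice_def by metis
  also have "\<dots> = (\<Sum>c\<in>Basis. scale (f (T c)) (slice (\<lambda>u. coord c (S u)) m))"
    unfolding slice_def sw_sum[symmetric]
    by (subst lin_sw[of "scale _"], intro lin_intros) simp
  finally have "slice f m = (\<Sum>c\<in>Basis. scale (f (T c)) (slice (\<lambda>u. coord c (S u)) m))" .
  then show ?thesis
    using I slice_S by (auto intro!: subspace_sum subspace_scale)
qed

text \<open>
  \<open>U = galois_map(H \<otimes> I)\<close> is an \<open>M\<close>-submodule by \<open>act_galois_map\<close>, since \<open>\<Sum> xS(m\<^sub>1) \<otimes> m\<^sub>2y\<close> stays in
  \<open>H \<otimes> I\<close> for \<open>m \<in> M\<close> and \<open>y \<in> I\<close>. The same formula with \<open>h\<close> in place of \<open>m\<close> puts \<open>HU\<close> into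
  \<open>galois_map(H \<otimes> HI)\<close>.
\<close>

lemma left_ideal_in_dims:
  assumes M: "subalgebra M" "left_coideal M" and I: "left_ideal_in M I"
  shows "submodule M (galois_map ` funs Basis I)"
    and "galois_map ` funs Basis I \<subseteq> funs Basis M"
    and "fv.dim (galois_map ` funs Basis I) = card Basis * dim I"
    and "fv.dim (generated (galois_map ` funs Basis I)) \<le> card Basis * dim (left_span I)"
proof -
  have sub: "subspace I" "I \<subseteq> M" and ideal: "\<And>m x. m \<in> M \<Longrightarrow> x \<in> I \<Longrightarrow> m * x \<in> I"
    using I by (auto simp: left_ideal_in_def)
  interpret galois_map: Vector_Spaces.linear fscale fscale galois_map by (rule linear_galois_map)
  have dim: "fv.dim (galois_map ` funs Basis K) = card Basis * dim K" if "subspace K" for K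
    using ff.dim_image_inj_on[OF linear_galois_map inj_on_subset[OF inj_on_galois_map funs_mono] subspace_funs[OF that]]
      dim_funs[OF finite_Basis that] by simp
  show "fv.dim (galois_map ` funs Basis I) = card Basis * dim I"
    using dim sub(1) .
  show "submodule M (galois_map ` funs Basis I)"
    unfolding submodule_def
  proof (intro conjI ballI)
    show "fv.subspace (galois_map ` funs Basis I)"
      by (intro galois_map.subspace_image subspace_funs sub)
    show "galois_map ` funs Basis I \<subseteq> tensors"
      using galois_map_tensors by blast
    show "act m z \<in> galois_map ` funs Basis I" if "m \<in> M" "z \<in> galois_map ` funs Basis I" for m z
    proof -
      from that(2) obtain w where w: "w \<in> funs Basis I" "z = galois_map w" by blast
      show ?thesis
        unfolding w(2) using w(1) that(1)
        by (intro act_galois_map_in[where K = I] sub(1) ideal slice_in_left_coideal[OF M(2)])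
          (auto simp: funs_def)
    qed
  qed
  show "galois_map ` funs Basis I \<subseteq> funs Basis M"
    using galois_map_tensors sub(2)
    by (auto simp: funs_def galois_map_def intro!: subspace_sum[OF subspace_left_coideal[OF M(2)]]
        slice_in_left_coideal[OF M(2)] form_coord_mult)
  have "generated (galois_map ` funs Basis I) \<subseteq> galois_map ` funs Basis (left_span I)"
  proof (rule generated_minimal)
    show "fv.subspace (galois_map ` funs Basis (left_span I))"
      by (intro galois_map.subspace_image subspace_funs subspace_left_span)
    fix h z assume "z \<in> galois_map ` funs Basis I"
    then obtain w where w: "w \<in> funs Basis I" "z = galois_map w" by blast
    show "act h z \<in> galois_map ` funs Basis (left_span I)"
      unfolding w(2) using w(1)
      by (intro act_galois_map_in[where K = I] subspace_left_span mult_in_left_span) (auto simp: funs_def)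
  qed
  then have "fv.dim (generated (galois_map ` funs Basis I)) \<le> fv.dim (galois_map ` funs Basis (left_span I))"
    using galois_map_tensors by (intro dim_mono_tensors) auto
  then show "fv.dim (generated (galois_map ` funs Basis I)) \<le> card Basis * dim (left_span I)"
    by (simp add: dim subspace_left_span)
qed

lemma generated_funs:
  assumes M: "subalgebra M" shows "generated (funs Basis M) = tensors"
proof
  have sub: "subspace M" "1 \<in> M"
    using M by (auto simp: subalgebra_def)
  show "generated (funs Basis M) \<subseteq> tensors"
    by (intro generated_tensors funs_mono) simp
  show "tensors \<subseteq> generated (funs Basis M)"
  proof
    fix z assume z: "z \<in> tensors"
    let ?d = "\<lambda>b. (\<lambda>b'. if b' = b then 1 else 0) :: 'h \<Rightarrow> 'h"
    have "z = (\<Sum>b\<in>Basis. act (z b) (?d b))"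
      using z finite_Basis by (auto simp: fun_eq_iff sum_fun_apply act_def funs_def if_distrib cong: if_cong)
    also have "\<dots> \<in> generated (funs Basis M)"
      using sub by (intro fv.subspace_sum[OF subspace_generated] act_in_generated)
        (auto simp: funs_def subspace_0)
    finally show "z \<in> generated (funs Basis M)" .
  qed
qed

text \<open>
  With \<open>D = dim H\<close>, \<open>U = galois_map(H \<otimes> I)\<close> and \<open>y = 1 \<otimes> 1\<close>, the chain \<open>U \<subseteq> U + Jy \<subseteq> U + My \<subseteq> H \<otimes> M\<close>
  generates a chain that grows by at most \<open>c dim J\<close>, then \<open>dim (H/HJ)\<close>, then the bound for the rest. In
  total it grows by at least \<open>D dim (H/HI) = cD dim (M/I)\<close>, because \<open>I\<close> attains the maximum \<open>c\<close>.
  What remains for the middle step is \<open>c dim (M/J)\<close>.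
\<close>

lemma left_ideal_ratio:
  assumes S: "inj S" and M: "subalgebra M" "left_coideal M"
    and I: "left_ideal_in M I" "left_span I \<noteq> UNIV"
    and c: "\<And>J. left_ideal_in M J \<Longrightarrow>
      real (card Basis) - real (dim (left_span J)) \<le> c * (real (dim M) - real (dim J))"
    and cI: "real (card Basis) - real (dim (left_span I)) = c * (real (dim M) - real (dim I))"
    and J: "left_ideal_in M J"
  shows "real (card Basis) - real (dim (left_span J)) = c * (real (dim M) - real (dim J))"
proof (rule antisym[OF c[OF J]])
  let ?D = "card Basis"
  let ?y = "pure_tensor 1 1" and ?U = "galois_map ` funs Basis I"
  let ?U1 = "fv.span (?U \<union> (\<lambda>m. act m ?y) ` M)" and ?UJ = "fv.span (?U \<union> (\<lambda>m. act m ?y) ` J)"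
  note U = left_ideal_in_dims[OF M I(1)]
  have MM: "subspace M" "1 \<in> M" "\<And>x y. x \<in> M \<Longrightarrow> y \<in> M \<Longrightarrow> x * y \<in> M"
    using M by (auto simp: subalgebra_def)
  have II: "subspace I" and JJ: "subspace J" "J \<subseteq> M"
    using I J by (auto simp: left_ideal_in_def)
  have idM: "left_ideal_in M M"
    using MM by (auto simp: left_ideal_in_def)
  have act_y: "act h ?y = pure_tensor 1 h" for h
    by (auto simp: act_def pure_tensor_def scale_mult_right)
  have y: "?y \<in> tensors"
    by (auto simp: pure_tensor_def funs_def coord_outside)
  have inj: "m = 0" if "act m ?y \<in> ?U" for m
  proof (rule ccontr)
    assume "m \<noteq> 0"
    have "slice f m \<in> I" if "form f" for f
      using \<open>act m ?y \<in> ?U\<close> slice_in_if_pure_tensor_in_galois_image[OF S II _ that] by (simp add: act_y)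
    from slices_in_left_ideal_trivial[OF this \<open>m \<noteq> 0\<close>] I(2) show False by blast
  qed
  have zero: "act 0 ?y \<in> ?U"
    using U(1) by (auto simp: submodule_def act_def fv.subspace_0 simp flip: zero_fun_def)
  have dim0: "dim {0} = 0"
    by simp
  have dimU: "fv.dim (fv.span (?U \<union> (\<lambda>m. act m ?y) ` Q)) = ?D * dim I + dim Q"
    if "subspace Q" for Q
    using dim_add_cyclic[OF U(1) y subspace_single_0 that] inj zero subspace_0[OF that]
    by (auto simp: U(3))
  have subJ: "submodule M ?UJ" and sub1: "submodule M ?U1"
    by (intro submodule_add_cyclic[OF M(1) U(1) y] J idM)+
  have sube: "submodule M (funs Basis M)"
    unfolding submodule_def
  proof (intro conjI ballI subspace_funs MM(1) funs_mono subset_UNIV)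
    show "act m z \<in> funs Basis M" if "m \<in> M" "z \<in> funs Basis M" for m z
      using that MM(3) by (auto simp: funs_def act_def)
  qed
  have U1e: "?U1 \<subseteq> funs Basis M"
  proof (rule fv.span_minimal)
    show "?U \<union> (\<lambda>m. act m ?y) ` M \<subseteq> funs Basis M"
      unfolding act_y using U(2) MM(1)
      by (auto simp: pure_tensor_def coord_outside subspace_scale funs_def[of Basis M])
  qed (rule subspace_funs[OF MM(1)])
  have "real (fv.dim (generated ?UJ)) - real (fv.dim (generated ?U)) \<le>
      c * (real (fv.dim ?UJ) - real (fv.dim ?U))"
    by (rule dim_generated_growth[OF M(1) c U(1) subJ]) (auto intro: fv.span_base)
  then have 1: "real (fv.dim (generated ?UJ)) - real (fv.dim (generated ?U)) \<le> c * real (dim J)"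
    by (simp only: dimU[OF JJ(1)] U(3)) simp
  have "real (fv.dim (generated (funs Basis M))) - real (fv.dim (generated ?U1)) \<le>
      c * (real (fv.dim (funs Basis M)) - real (fv.dim ?U1))"
    by (rule dim_generated_growth[OF M(1) c sub1 sube U1e])
  then have 2: "real ?D * real ?D - real (fv.dim (generated ?U1)) \<le>
      c * (real ?D * real (dim M) - (real ?D * real (dim I) + real (dim M)))"
    by (simp only: dimU[OF MM(1)] generated_funs[OF M(1)] dim_funs[OF finite_Basis MM(1)]
        dim_funs[OF finite_Basis subspace_UNIV]) simp
  have U1J: "?U1 = fv.span (?UJ \<union> (\<lambda>m. act m ?y) ` M)"
  proof
    show "?U1 \<subseteq> fv.span (?UJ \<union> (\<lambda>m. act m ?y) ` M)"
      by (intro fv.span_mono) (auto intro: fv.span_base)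
    show "fv.span (?UJ \<union> (\<lambda>m. act m ?y) ` M) \<subseteq> ?U1"
      using JJ(2) fv.span_mono[of "?U \<union> (\<lambda>m. act m ?y) ` J" "?U \<union> (\<lambda>m. act m ?y) ` M"]
      by (intro fv.span_minimal) (auto intro: fv.span_base)
  qed
  have "fv.dim (generated ?U1) + dim (left_span J) \<le> fv.dim (generated ?UJ) + ?D"
    unfolding U1J using subJ y
    by (intro generated_add_cyclic) (auto simp: submodule_def intro: fv.span_base)
  then have 3: "real (fv.dim (generated ?U1)) + real (dim (left_span J)) \<le>
      real (fv.dim (generated ?UJ)) + real ?D"
    by linarith
  have 4: "real (fv.dim (generated ?U)) \<le> real ?D * real (dim (left_span I))"
    using U(4) by (metis of_nat_le_iff of_nat_mult)
  have 5: "real ?D * real ?D - real ?D * real (dim (left_span I)) =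
      c * (real ?D * real (dim M) - real ?D * real (dim I))"
    using arg_cong[OF cI, of "\<lambda>x. real ?D * x"] by (simp add: algebra_simps)
  have "c * (real ?D * real (dim M) - (real ?D * real (dim I) + real (dim M))) =
      c * (real ?D * real (dim M) - real ?D * real (dim I)) - c * real (dim M)"
    by (simp add: algebra_simps)
  with 1 2 3 4 5 have "c * real (dim M) - c * real (dim J) \<le> real ?D - real (dim (left_span J))"
    by linarith
  then show "c * (real (dim M) - real (dim J)) \<le> real ?D - real (dim (left_span J))"
    by (simp add: right_diff_distrib)
qed

lemma ideal_of_eq_left_span: "ideal_of M = left_span (augmentation M)"
  by (simp add: ideal_of_def left_span_def)

lemma eps_ideal_of: "x \<in> ideal_of M \<Longrightarrow> \<epsilon> x = 0"
proof -
  have "subspace {x. \<epsilon> x = 0}"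
    using form_scale[OF form_eps_raw, of 0 0]
    by (auto simp: subspace_def form_add[OF form_eps_raw] form_scale[OF form_eps_raw])
  then have "ideal_of M \<subseteq> {x. \<epsilon> x = 0}"
    unfolding ideal_of_def by (intro span_minimal) (auto simp: augmentation_def \<epsilon>_mult)
  then show "x \<in> ideal_of M \<Longrightarrow> \<epsilon> x = 0" by blast
qed

text \<open>
  Only finitely many ratios occur, so the maximum \<open>c\<close> exists; it is positive because \<open>HM\<^sup>+\<close> lies in
  \<open>ker \<epsilon>\<close>.
\<close>

lemma dim_formula:
  assumes S: "inj S" and M: "subalgebra M" "left_coideal M"
  shows "real (card Basis) = (real (card Basis) - real (dim (ideal_of M))) * real (dim M)"
proof -
  let ?D = "real (card Basis)" and ?A = "augmentation M"
  have MM: "subspace M" "1 \<in> M" "\<And>x y. x \<in> M \<Longrightarrow> y \<in> M \<Longrightarrow> x * y \<in> M"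
    using M by (auto simp: subalgebra_def)
  define r where "r I = (?D - real (dim (left_span I))) / (real (dim M) - real (dim I))" for I
  define \<I> where "\<I> = {I. left_ideal_in M I \<and> I \<noteq> M}"
  have subA: "subspace ?A"
    using MM(1) form_scale[OF form_eps_raw, of 0 0]
    by (auto simp: augmentation_def subspace_def form_add[OF form_eps_raw] form_scale[OF form_eps_raw])
  have A: "left_ideal_in M ?A"
    using MM subA by (auto simp: left_ideal_in_def augmentation_def \<epsilon>_mult)
  have "1 \<notin> ?A"
    by (simp add: augmentation_def \<epsilon>_one)
  then have A\<I>: "?A \<in> \<I>"
    using A MM(2) by (auto simp: \<I>_def)
  have bound: "dim X \<le> card Basis" for X
    using dim_subset_UNIV[of X] by (simp add: dimension_def)
  have less: "dim I < dim M" if "I \<in> \<I>" for I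
    using that MM(1)
    by (intro dim_psubset) (auto simp: \<I>_def left_ideal_in_def span_eq_iff[THEN iffD2])
  have "r ` \<I> \<subseteq> (\<lambda>(a, b, d). (?D - real a) / (real (dim M) - real b)) `
      ({..card Basis} \<times> {..card Basis} \<times> {..card Basis})"
  proof
    fix x assume "x \<in> r ` \<I>"
    then obtain I where "x = r I" by blast
    then show "x \<in> (\<lambda>(a, b, d). (?D - real a) / (real (dim M) - real b)) `
      ({..card Basis} \<times> {..card Basis} \<times> {..card Basis})"
      using bound by (intro image_eqI[of _ _ "(dim (left_span I), dim I, 0)"]) (auto simp: r_def)
  qed
  then have fin: "finite (r ` \<I>)"
    by (rule finite_subset) auto
  define c where "c = Max (r ` \<I>)"
  have "c \<in> r ` \<I>"
    unfolding c_def using fin A\<I> by (intro Max_in) auto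
  then obtain I where I: "I \<in> \<I>" "c = r I" by blast
  have idI: "left_ideal_in M I"
    using I(1) by (simp add: \<I>_def)
  have c: "?D - real (dim (left_span J)) \<le> c * (real (dim M) - real (dim J))"
    if J: "left_ideal_in M J" for J
  proof (cases "J = M")
    case True
    have "h * 1 \<in> left_span J" for h
      using MM(2) True by (intro mult_in_left_span) simp
    then have "left_span J = UNIV" by auto
    then show ?thesis by (simp add: True)
  next
    case False
    then have "J \<in> \<I>" using J by (simp add: \<I>_def)
    then have "r J \<le> c"
      unfolding c_def using fin by (intro Max_ge) auto
    then show ?thesis
      using less[OF \<open>J \<in> \<I>\<close>] by (simp add: r_def divide_le_eq)
  qed
  have cI: "?D - real (dim (left_span I)) = c * (real (dim M) - real (dim I))"
    using less[OF I(1)] by (simp add: I(2) r_def)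
  have "left_span ?A \<noteq> UNIV"
    using eps_ideal_of[of 1 M] by (auto simp: \<epsilon>_one simp flip: ideal_of_eq_left_span)
  then have "dim (left_span ?A) < card Basis"
    using dim_psubset[of "left_span ?A" UNIV] by (auto simp: span_eq_iff[THEN iffD2] subspace_left_span)
  then have "0 < r ?A"
    using less[OF A\<I>] by (simp add: r_def)
  also have "r ?A \<le> c"
    unfolding c_def using fin A\<I> by (intro Max_ge) auto
  finally have "0 < c" .
  then have "0 < ?D - real (dim (left_span I))"
    unfolding cI using less[OF I(1)] by simp
  then have I_ne: "left_span I \<noteq> UNIV" by auto
  have ratio: "?D - real (dim (left_span J)) = c * (real (dim M) - real (dim J))"
    if "left_ideal_in M J" for J
    by (rule left_ideal_ratio[OF S M idI I_ne _ cI that]) (rule c)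
  have zero: "left_ideal_in M {0}"
    using MM(1) by (auto simp: left_ideal_in_def subspace_0)
  have "left_span {0} = {0}"
    by (simp add: left_span_def)
  with ratio[OF zero] have D: "?D = c * real (dim M)" by simp
  have "M = span (insert 1 ?A)"
  proof
    show "span (insert 1 ?A) \<subseteq> M"
      using MM by (intro span_minimal) (auto simp: augmentation_def)
    show "M \<subseteq> span (insert 1 ?A)"
    proof
      fix x assume x: "x \<in> M"
      have "x - scale (\<epsilon> x) 1 \<in> ?A"
        using x MM form_add[OF form_eps_raw, of "x - scale (\<epsilon> x) 1" "scale (\<epsilon> x) 1"]
        by (auto simp: augmentation_def form_scale[OF form_eps_raw] \<epsilon>_one
            intro!: subspace_diff subspace_scale)
      then have "(x - scale (\<epsilon> x) 1) + scale (\<epsilon> x) 1 \<in> span (insert 1 ?A)"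
        by (intro span_add span_scale) (auto intro: span_base)
      then show "x \<in> span (insert 1 ?A)" by simp
    qed
  qed
  then have "dim M = dim (insert 1 ?A)"
    by (metis dim_span)
  also have "\<dots> = Suc (dim ?A)"
    using \<open>1 \<notin> ?A\<close> subA by (simp add: dim_insert span_eq_iff[THEN iffD2])
  finally have "?D - real (dim (left_span ?A)) = c"
    using ratio[OF A] by simp
  with D show ?thesis by (simp add: ideal_of_eq_left_span)
qed

lemma left_coideal_subalgebra_eqI:
  assumes S: "inj S" and M: "subalgebra M" "left_coideal M" and N: "subalgebra N" "left_coideal N"
    and "M \<subseteq> N" "augmentation N \<subseteq> ideal_of M"
  shows "M = N"
proof -
  have sub: "subspace M" "subspace N"
    using M N by (auto simp: subalgebra_def)
  have "ideal_of N = ideal_of M"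
  proof
    show "ideal_of N \<subseteq> ideal_of M"
      unfolding ideal_of_def[of N] using assms(7) ideal_of_mult_left subspace_ideal_of
      by (intro span_minimal) auto
    show "ideal_of M \<subseteq> ideal_of N"
      unfolding ideal_of_def using assms(6) by (intro span_mono) (auto simp: augmentation_def)
  qed
  then have "(real (card Basis) - real (dim (ideal_of M))) * real (dim M) =
      (real (card Basis) - real (dim (ideal_of M))) * real (dim N)"
    using dim_formula[OF S M] dim_formula[OF S N] by simp
  moreover have "card Basis \<noteq> 0"
    using finite_Basis span_Basis zero_neq_one by (metis UNIV_I card_0_eq singletonD span_empty)
  then have "real (card Basis) - real (dim (ideal_of M)) \<noteq> 0"
    using dim_formula[OF S M] by (metis mult_zero_left of_nat_eq_0_iff)
  ultimately have "dim M = dim N" by simp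
  then show ?thesis
    using sub assms(6) by (intro subspace_dim_equal) auto
qed

section \<open>The commutator subalgebra\<close>

text \<open>
  The elements that are congruent to a scalar modulo the two-sided ideal \<open>HM\<^sup>+\<close> form a subalgebra that
  contains \<open>M\<close> and all commutators, hence the algebra \<open>N\<close> generated by both. So \<open>HN\<^sup>+ = HM\<^sup>+\<close>,
  and \<open>N = M\<close> by dimensions.
\<close>

lemma commutators_in_normal_subalgebra:
  assumes S: "inj S" and M: "normal_left_coideal_subalgebra M" "commutative_quotient M"
  shows "comm_algebra \<subseteq> M"
proof -
  have M': "subalgebra M" "left_coideal M"
    using M(1) by (auto simp: normal_left_coideal_subalgebra_def)
  have MM: "subspace M"
    using M' by (auto simp: subalgebra_def)
  let ?X = "M \<union> comm_algebra"
  let ?N = "algebra_generated ?X"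
  let ?K = "ideal_of M"
  let ?T = "{x. x - scale (\<epsilon> x) 1 \<in> ?K}"
  have N: "left_coideal ?N"
    by (rule left_coideal_algebra_generated)
      (use algebra_generated_superset[of ?X] slice_in_left_coideal[OF M'(2)]
        slice_in_left_coideal[OF left_coideal_comm_algebra] in blast)
  have "subalgebra ?T"
    unfolding subalgebra_def
  proof (intro conjI ballI)
    have eps0: "\<epsilon> 0 = 0"
      using form_scale[OF form_eps_raw, of 0 0] by simp
    show "subspace ?T"
      unfolding subspace_def
    proof (intro conjI ballI allI)
      show "0 \<in> ?T" by (simp add: eps0 subspace_0[OF subspace_ideal_of])
      show "x + y \<in> ?T" if "x \<in> ?T" "y \<in> ?T" for x y
        using subspace_add[OF subspace_ideal_of, of "x - scale (\<epsilon> x) 1" M "y - scale (\<epsilon> y) 1"] that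
        by (simp add: form_add[OF form_eps_raw] scale_left_distrib algebra_simps)
      show "scale c x \<in> ?T" if "x \<in> ?T" for c x
        using subspace_scale[OF subspace_ideal_of, of "x - scale (\<epsilon> x) 1" M c] that
        by (simp add: form_scale[OF form_eps_raw] scale_right_diff_distrib)
    qed
    show "1 \<in> ?T" by (simp add: \<epsilon>_one subspace_0[OF subspace_ideal_of])
    show "x * y \<in> ?T" if "x \<in> ?T" "y \<in> ?T" for x y
    proof -
      have "(x - scale (\<epsilon> x) 1) * y + scale (\<epsilon> x) 1 * (y - scale (\<epsilon> y) 1) \<in> ?K"
        using that commutative_quotient_mult_right[OF M(2)] ideal_of_mult_left
        by (intro subspace_add[OF subspace_ideal_of]) auto
      moreover have "(x - scale (\<epsilon> x) 1) * y + scale (\<epsilon> x) 1 * (y - scale (\<epsilon> y) 1) =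
          x * y - scale (\<epsilon> (x * y)) 1"
        by (simp add: left_diff_distrib right_diff_distrib scale_mult_left scale_mult_right \<epsilon>_mult
            scale_right_diff_distrib)
      ultimately show ?thesis by simp
    qed
  qed
  moreover have "M \<subseteq> ?T"
  proof
    fix x assume x: "x \<in> M"
    have "x - scale (\<epsilon> x) 1 \<in> augmentation M"
      using x M'(1) form_add[OF form_eps_raw, of "x - scale (\<epsilon> x) 1" "scale (\<epsilon> x) 1"]
      by (auto simp: augmentation_def subalgebra_def form_scale[OF form_eps_raw] \<epsilon>_one
          intro!: subspace_diff subspace_scale)
    then have "1 * (x - scale (\<epsilon> x) 1) \<in> ?K"
      unfolding ideal_of_eq_left_span by (rule mult_in_left_span)
    then show "x \<in> ?T" by simp
  qed
  moreover have "comm_algebra \<subseteq> ?T" if "subalgebra ?T"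
    using comm_trivial_in_quotient[OF M(2)] that by (intro comm_algebra_minimal) auto
  ultimately have "?N \<subseteq> ?T"
    by (intro algebra_generated_minimal) auto
  then have "augmentation ?N \<subseteq> ?K"
    by (auto simp: augmentation_def)
  then have "M = ?N"
    using algebra_generated_superset[of ?X]
    by (intro left_coideal_subalgebra_eqI[OF S M' subalgebra_algebra_generated N]) auto
  then show ?thesis
    using algebra_generated_superset[of ?X] by blast
qed

lemma is_commutator_subalgebra_iff:
  assumes "semisimple"
  shows "is_commutator_subalgebra N \<longleftrightarrow> N = comm_algebra"
proof -
  note S = inj_S[OF assms] surj_S[OF assms]
  have "normal_left_coideal_subalgebra comm_algebra" "commutative_quotient comm_algebra"
    by (simp_all add: normal_left_coideal_subalgebra_def subalgebra_comm_algebra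
        left_coideal_comm_algebra normal_comm_algebra commutative_quotient_comm_algebra[OF S(2)])
  then show ?thesis
    unfolding is_commutator_subalgebra_def
    using commutators_in_normal_subalgebra[OF S(1)] by (metis subset_antisym)
qed

end

theorem proposition2p5:
  fixes scale :: "'k::{alg_closed_field, field_char_0} \<Rightarrow> 'h::ring_1 \<Rightarrow> 'h"
    and \<Delta> :: "'h \<Rightarrow> ('h \<times> 'h) list"
    and \<epsilon> :: "'h \<Rightarrow> 'k"
    and S :: "'h \<Rightarrow> 'h"
    and B :: "'h set"
    and n :: nat
  assumes "hopf_algebra scale \<Delta> \<epsilon> S"
    and "finite_dimensional_vector_space scale B"
    and "k_algebra.semisimple scale"
    and "n > 1"
  shows "(\<forall>N. hopf_algebra.is_commutator_subalgebra scale \<Delta> \<epsilon> S N \<longleftrightarrow>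
              N = k_algebra.algebra_generated scale (hopf_algebra.Com scale \<Delta> S n)) \<and>
         (\<forall>as. length as = n \<longrightarrow>
              hopf_algebra.commutator \<Delta> S as
                \<in> module.span scale {prod_list cs | cs. cs \<noteq> [] \<and>
                    set cs \<subseteq> {hopf_algebra.commutator \<Delta> S [a, b] | a b. True}})"
proof -
  interpret finite_hopf_algebra scale \<Delta> \<epsilon> S B
    using assms(1,2) by (simp add: finite_hopf_algebra_def)
  show ?thesis
    using is_commutator_subalgebra_iff[OF assms(3)] algebra_generated_Com[OF assms(4)]
      commutator_in_span_products assms(4)
    by (simp add: commutator_two_comm)
qed

end
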